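(* Let $g\in C(\mathbb{R})\cap L^{\infty}(\mathbb{R})$ be a probability density function on $\mathbb{R}$, and let $u=u(x,t)$ be the bounded solution to the Cauchy problem $$\frac{\partial u}{\partial t}=\frac12\,\frac{\partial^2 u}{\partial x^2}\quad\text{for }(x,t)\in\mathbb{R}\times(0,\infty),\qquad u(x,0)=g(x)\quad\text{for }x\in\mathbb{R}.$$ Then for each $n\in\{1,2,3,4,5\}$, $$(-1)^{n+1}\,\frac{d^n}{dt^n}H_{\alpha}[u(t)]\ge 0\qquad\text{for all } t>0$$ holds for the following values of $\alpha$: - $n=1$: $\alpha\in(0,1)\cup(1,\infty)$; - $n=2$: $\alpha\in(0,1)\cup(1,3]$; - $n=3$: $\alpha\in(\alpha_0,1)\cup(1,2]$, where $\alpha_0\approx 0.389214$ is the real root of $9\alpha^3-12\alpha^2+29\alpha-10=0$; - $n=4$: $\alpha\in(1,2)$; - $n=5$: $\alpha\in(\alpha_1,2)$, for some number $\alpha_1\in(1.54,1.55)$ (not depending on $g$).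
   Context: For a probability density function $w$ on $\mathbb{R}$ and a constant $\alpha\in(0,1)\cup(1,\infty)$, the Tsallis entropy is $$H_{\alpha}[w]=\frac{1}{\alpha-1}\left(1-\int_{\mathbb{R}} w(x)^{\alpha}\,dx\right).$$ $H_\alpha[u(t)]$ denotes $H_\alpha$ applied to the function $x\mapsto u(x,t)$. The bounded solution of the Cauchy problem is unique and is given by $$u(x,t)=\frac{1}{\sqrt{2\pi t}}\int_{-\infty}^{\infty} g(y)\,e^{-\frac{(y-x)^2}{2t}}\,dy .$$ *)

theory Defs
  imports "HOL-Analysis.Analysis"
begin

definition prob_density :: "(real \<Rightarrow> real) \<Rightarrow> bool" where
  "prob_density w \<longleftrightarrow>
     (\<forall>x. 0 \<le> w x) \<and> integrable lborel w \<and> (LINT x|lborel. w x) = 1"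

(* For \<alpha> < 1 the integral of w^\<alpha> may diverge even though w is a density; the Bochner integral
   is then 0 by convention and the value is the constant 1 / (\<alpha> - 1).  For \<alpha> > 1 and a bounded
   density the integral always converges. *)
definition tsallis_entropy :: "real \<Rightarrow> (real \<Rightarrow> real) \<Rightarrow> real" where
  "tsallis_entropy \<alpha> w = 1 / (\<alpha> - 1) * (1 - (LINT x|lborel. w x powr \<alpha>))"

(* Classical solutions: continuous up to t = 0, so that the initial condition is attained, with
   pointwise partial derivatives for t > 0.  The values u x t for t < 0 are irrelevant. *)
definition heat_cauchy_solution :: "(real \<Rightarrow> real) \<Rightarrow> (real \<Rightarrow> real \<Rightarrow> real) \<Rightarrow> bool" where
  "heat_cauchy_solution g u \<longleftrightarrow>
     continuous_on (UNIV \<times> {0..}) (\<lambda>(x, t). u x t) \<and>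
     (\<forall>x. u x 0 = g x) \<and>
     (\<forall>x. \<forall>t>0.
        (\<lambda>s. u x s) differentiable (at t) \<and>
        (\<lambda>y. u y t) differentiable (at x) \<and>
        deriv (\<lambda>y. u y t) differentiable (at x) \<and>
        deriv (\<lambda>s. u x s) t = 1 / 2 * (deriv ^^ 2) (\<lambda>y. u y t) x)"

definition bounded_heat_cauchy_solution :: "(real \<Rightarrow> real) \<Rightarrow> (real \<Rightarrow> real \<Rightarrow> real) \<Rightarrow> bool" where
  "bounded_heat_cauchy_solution g u \<longleftrightarrow>
     heat_cauchy_solution g u \<and> bounded ((\<lambda>(x, t). u x t) ` (UNIV \<times> {0..}))"

(* Guards against deriv being unspecified at points of non-differentiability: the n-th
   derivative at t counts as existing only if all lower ones are differentiable on t > 0. *)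
definition times_differentiable_pos :: "nat \<Rightarrow> (real \<Rightarrow> real) \<Rightarrow> bool" where
  "times_differentiable_pos n h \<longleftrightarrow> (\<forall>k<n. \<forall>t>0. (deriv ^^ k) h differentiable (at t))"

definition alpha0 :: real where
  "alpha0 = (THE a. 9 * a ^ 3 - 12 * a ^ 2 + 29 * a - 10 = 0)"

lemma alpha0_cubic_strict_mono:
  "strict_mono (\<lambda>a::real. 9 * a ^ 3 - 12 * a ^ 2 + 29 * a - 10)"
proof (rule strict_monoI)
  fix a b :: real
  assume ab: "a < b"
  have "(9 * b ^ 3 - 12 * b ^ 2 + 29 * b - 10) - (9 * a ^ 3 - 12 * a ^ 2 + 29 * a - 10)
        = (b - a) * (9 / 2 * (a - 4 / 3) ^ 2 + 9 / 2 * (b - 4 / 3) ^ 2 + 9 / 2 * (a + b) ^ 2 + 13)"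
    by (simp add: power2_eq_square power3_eq_cube algebra_simps)
  also have "\<dots> > 0"
    using ab by (intro mult_pos_pos) (auto intro!: add_nonneg_pos)
  finally show "9 * a ^ 3 - 12 * a ^ 2 + 29 * a - 10 < 9 * b ^ 3 - 12 * b ^ 2 + 29 * b - 10"
    by simp
qed

lemma alpha0_cubic_ex1: "\<exists>!a::real. 9 * a ^ 3 - 12 * a ^ 2 + 29 * a - 10 = 0"
  and alpha0_root: "9 * alpha0 ^ 3 - 12 * alpha0 ^ 2 + 29 * alpha0 - 10 = 0"
  and alpha0_approx: "\<bar>alpha0 - 0.389214\<bar> < 0.0000005"
proof -
  let ?p = "\<lambda>a::real. 9 * a ^ 3 - 12 * a ^ 2 + 29 * a - 10"
  have "\<exists>a\<ge>0.3892136. a \<le> 0.3892139 \<and> ?p a = 0"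
    by (rule IVT') (auto intro!: continuous_intros simp: power2_eq_square power3_eq_cube)
  then obtain a where a: "0.3892136 \<le> a" "a \<le> 0.3892139" "?p a = 0"
    by blast
  have uniq: "b = a" if "?p b = 0" for b
    using strict_mono_eq[OF alpha0_cubic_strict_mono, of b a] a(3) that by simp
  show "\<exists>!a. ?p a = 0"
    using a(3) uniq by blast
  have "alpha0 = a"
    unfolding alpha0_def using a(3) uniq by (rule the_equality)
  then show "?p alpha0 = 0" "\<bar>alpha0 - 0.389214\<bar> < 0.0000005"
    using a by simp_all
qed

end

theory Submission
  imports Defs "HOL-Probability.Distributions"
begin

text \<open>Write \<open>u\<^sub>k\<close> for the \<open>k\<close>-th spatial derivative of the solution and \<open>y\<^sub>k = u\<^sub>k / u\<close>.  Since
\<open>u\<close> solves the heat equation, every time derivative of \<open>u\<^sup>\<alpha>\<close> is \<open>u\<^sup>\<alpha>\<close> times a polynomial in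
the \<open>y\<^sub>k\<close>, and so is every spatial derivative.  An integral of \<open>u\<^sup>\<alpha> Q(y)\<close> is called a moment.
Two rules govern moments: the time derivative of the moment of \<open>Q\<close> is half the moment of
\<open>total 2 \<alpha> Q\<close>, and the moment of \<open>total 1 \<alpha> R\<close>, the integral of a spatial derivative, is
zero.  These rules turn the theorem into algebra.  Integration by parts brings
\<open>(-1)\<^bsup>n+1\<^esup> d\<^sup>n/dt\<^sup>n H\<close> into the form \<open>\<alpha>/2 (1/2)\<^bsup>n-1\<^esup>\<close> times the moment of a polynomial
\<open>dissip n \<alpha>\<close>, starting from \<open>y\<^sub>1\<^sup>2\<close>, and it remains to add a suitable \<open>total 1 \<alpha> R\<close> to this
polynomial that makes it a sum of squares.

With \<open>s = 2 - \<alpha>\<close> such a representation is explicit for \<open>n \<le> 3\<close>; the cubic that defines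
\<open>alpha0\<close> is the coefficient of \<open>y\<^sub>1\<^sup>6\<close> that is left for \<open>n = 3\<close> (\<open>dissip_sos3\<close>).  For
\<open>n = 4\<close> and \<open>n = 5\<close> the square of a form with leading term \<open>y\<^sub>n\<close> is split off.  The rest
is \<open>s\<close> times a quadratic form in the other monomials of weight \<open>n\<close>, whose Gram matrix is
polynomial in \<open>s\<close>.  This matrix is a combination of constant positive definite matrices
with Bernstein polynomials as coefficients, which are nonnegative on \<open>1 \<le> \<alpha> \<le> 2\<close> for
\<open>n = 4\<close> and on \<open>3/2 \<le> \<alpha> \<le> 2\<close> for \<open>n = 5\<close> (\<open>dissip_sos4\<close>, \<open>dissip_sos5\<close>).
So any \<open>\<alpha>\<^sub>1\<close> between \<open>1.54\<close> and \<open>1.55\<close> is a valid choice.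

The analytic part justifies the two rules.  A bounded solution is the Gaussian convolution of
\<open>g\<close> by the maximum principle (\<open>bounded_heat_cauchy_solution_unique\<close>).  The quotients \<open>y\<^sub>k\<close>
are unbounded, but each of them is dominated by an arbitrarily small power of
\<open>u(x, b') / u(x, t)\<close> for a later time \<open>b'\<close> (\<open>tame_heat_quotient\<close>).  Hence all integrands are
dominated, uniformly for \<open>t\<close> in a compact interval, by a multiple of \<open>u(x, b')\<^sup>\<alpha>\<close>, and
differentiation under the integral and integration by parts are allowed as soon as \<open>u\<^sup>\<alpha>\<close> is
integrable at all times.  For \<open>\<alpha> > 1\<close> this holds because \<open>u\<close> is bounded and integrable.  For
\<open>\<alpha> < 1\<close> it holds at all times or at none (\<open>integrable_heat_powr_propagates\<close>); in the second
case the entropy is constant in time because a divergent integral has the value zero.\<close>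

section \<open>Differentiation and integration by parts on the line\<close>

text \<open>By the mean value theorem the difference quotients inherit the bound \<open>h\<close> on the
derivatives, so dominated convergence applies along every sequence tending to \<open>t0\<close>.\<close>

lemma has_real_derivative_integral:
  fixes f f' :: "'a \<Rightarrow> real \<Rightarrow> real"
  assumes t0: "a < t0" "t0 < b"
    and deriv: "\<And>t x. a < t \<Longrightarrow> t < b \<Longrightarrow> (f x has_real_derivative f' x t) (at t)"
    and bound: "\<And>t x. a < t \<Longrightarrow> t < b \<Longrightarrow> \<bar>f' x t\<bar> \<le> h x"
    and h: "integrable M h"
    and int: "\<And>t. a < t \<Longrightarrow> t < b \<Longrightarrow> integrable M (\<lambda>x. f x t)"
    and meas: "(\<lambda>x. f' x t0) \<in> borel_measurable M"
  shows "((\<lambda>t. LINT x|M. f x t) has_real_derivative (LINT x|M. f' x t0)) (at t0)"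
proof -
  let ?q = "\<lambda>t x. (f x t - f x t0) / (t - t0)"
  have "((\<lambda>t. LINT x|M. ?q t x) \<longlongrightarrow> (LINT x|M. f' x t0)) (at t0)"
    unfolding tendsto_at_iff_sequentially comp_def
  proof (intro allI impI)
    fix X :: "nat \<Rightarrow> real"
    assume X: "\<forall>i. X i \<in> UNIV - {t0}" and lim: "X \<longlonglongrightarrow> t0"
    have "\<forall>\<^sub>F n in sequentially. X n \<in> {a<..<b}"
      by (rule topological_tendstoD[OF lim]) (use t0 in auto)
    then obtain N where N: "\<And>n. n \<ge> N \<Longrightarrow> X n \<in> {a<..<b}"
      by (auto simp: eventually_sequentially)
    show "(\<lambda>n. LINT x|M. ?q (X n) x) \<longlonglongrightarrow> (LINT x|M. f' x t0)"
    proof (rule LIMSEQ_offset[where k = N], rule integral_dominated_convergence[OF meas _ h])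
      show "(\<lambda>x. ?q (X (n + N)) x) \<in> borel_measurable M" for n
        using int[of "X (n + N)"] int[of t0] N[of "n + N"] t0 by auto
      show "AE x in M. (\<lambda>n. ?q (X (n + N)) x) \<longlonglongrightarrow> f' x t0"
      proof (rule AE_I2)
        fix x
        have "((\<lambda>t. ?q t x) \<longlongrightarrow> f' x t0) (at t0)"
          using deriv[OF t0, of x] by (simp add: has_field_derivative_iff)
        then show "(\<lambda>n. ?q (X (n + N)) x) \<longlonglongrightarrow> f' x t0"
          using X lim unfolding tendsto_at_iff_sequentially comp_def
          by (auto intro!: LIMSEQ_ignore_initial_segment[where f = "\<lambda>n. ?q (X n) x"])
      qed
      show "AE x in M. norm (?q (X (n + N)) x) \<le> h x" for n
      proof (rule AE_I2)
        fix x
        let ?t = "X (n + N)"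
        have t: "a < ?t" "?t < b" using N[of "n + N"] by auto
        have ne: "?t \<noteq> t0" using X by auto
        have "norm (f x ?t - f x t0) \<le> h x * norm (?t - t0)"
        proof (rule field_differentiable_bound[where S = "{a<..<b}" and f' = "f' x"])
          show "(f x has_field_derivative f' x z) (at z within {a<..<b})" if "z \<in> {a<..<b}" for z
            using deriv that by (auto intro: has_field_derivative_at_within)
        qed (use t t0 bound in auto)
        then show "norm (?q ?t x) \<le> h x"
          using ne by (simp add: field_simps)
      qed
    qed
  qed
  moreover have "\<forall>\<^sub>F t in at t0. (LINT x|M. ?q t x) = ((LINT x|M. f x t) - (LINT x|M. f x t0)) / (t - t0)"
  proof -
    have "\<forall>\<^sub>F t in at t0. t \<in> {a<..<b}"
      using t0 by (intro eventually_at_in_open') auto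
    then show ?thesis
      by eventually_elim (use int t0 in auto)
  qed
  ultimately show ?thesis
    unfolding has_field_derivative_iff by (rule Lim_transform_eventually)
qed

text \<open>By Fubini, averaging \<open>f' (x + \<theta>)\<close> over \<open>0 \<le> \<theta> \<le> 1\<close> does not change the integral over the
line.  The average is \<open>f (x + 1) - f x\<close>, whose integral vanishes by translation invariance.\<close>

lemma integral_deriv_eq_0:
  fixes f f' :: "real \<Rightarrow> real"
  assumes deriv: "\<And>x. (f has_real_derivative f' x) (at x)"
    and cont: "continuous_on UNIV f'"
    and f: "integrable lborel f" and f': "integrable lborel f'"
  shows "(LINT x|lborel. f' x) = 0"
proof -
  interpret lborel_pair: pair_sigma_finite lborel lborel ..
  have [measurable]: "f' \<in> borel_measurable borel"
    using cont by (rule borel_measurable_continuous_onI)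
  have shift: "has_bochner_integral lborel (\<lambda>x. F (x + c)) (LINT x|lborel. F x)"
    if "integrable lborel F" for F :: "real \<Rightarrow> real" and c
    using lborel_has_bochner_integral_real_affine_iff[of 1 F "LINT x|lborel. F x" c] that
    by (simp add: has_bochner_integral_integrable add.commute)
  let ?G = "\<lambda>(x, \<theta>). indicator {0..1} \<theta> * f' (x + \<theta>)"
  let ?H = "\<lambda>\<theta> x. indicator {0..1} \<theta> * f' (x + \<theta>)"
  have "integrable (lborel \<Otimes>\<^sub>M lborel) (\<lambda>(\<theta>, x). ?H \<theta> x)"
  proof (rule lborel_pair.Fubini_integrable)
    show "(\<lambda>(\<theta>, x). ?H \<theta> x) \<in> borel_measurable (lborel \<Otimes>\<^sub>M lborel)"
      by measurable
    have "(LINT x|lborel. norm (?H \<theta> x)) = indicator {0..1} \<theta> * (LINT x|lborel. \<bar>f' x\<bar>)" for \<theta>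
      using has_bochner_integral_integral_eq[OF shift[of "\<lambda>x. \<bar>f' x\<bar>" \<theta>]] f'
      by (auto simp: abs_mult indicator_def)
    then show "integrable lborel (\<lambda>\<theta>. LINT x|lborel. norm (case (\<theta>, x) of (\<theta>, x) \<Rightarrow> ?H \<theta> x))"
      by simp
    show "AE \<theta> in lborel. integrable lborel (\<lambda>x. case (\<theta>, x) of (\<theta>, x) \<Rightarrow> ?H \<theta> x)"
      using shift[OF f'] by (auto simp: has_bochner_integral_iff)
  qed
  then have "(LINT x|lborel. LINT \<theta>|lborel. ?H \<theta> x) = (LINT \<theta>|lborel. LINT x|lborel. ?H \<theta> x)"
    by (rule lborel_pair.Fubini_integral)
  also have "\<dots> = (LINT \<theta>|lborel. indicator {0..1::real} \<theta> * (LINT x|lborel. f' x))"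
    using has_bochner_integral_integral_eq[OF shift[OF f']] by simp
  also have "\<dots> = (LINT x|lborel. f' x)"
    by simp
  finally have swap: "(LINT x|lborel. LINT \<theta>|lborel. ?H \<theta> x) = (LINT x|lborel. f' x)" .
  have "(LINT \<theta>|lborel. ?H \<theta> x) = f (x + 1) - f x" for x
  proof -
    have "(LINT \<theta>|lborel. f' (x + \<theta>) * indicator {0..1} \<theta>) = f (x + 1) - f (x + 0)"
    proof (rule integral_FTC_Icc_real)
      show "((\<lambda>\<theta>. f (x + \<theta>)) has_real_derivative f' (x + \<theta>)) (at \<theta>)" for \<theta>
      proof -
        have d: "((\<lambda>\<theta>. x + \<theta>) has_real_derivative 1) (at \<theta>)"
          by (auto intro!: derivative_eq_intros)
        show ?thesis
          using DERIV_chain'[OF d deriv] by simp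
      qed
      show "isCont (\<lambda>\<theta>. f' (x + \<theta>)) \<theta>" for \<theta>
        by (rule isCont_o2[where g = f']) (use cont in \<open>auto simp: continuous_on_eq_continuous_at\<close>)
    qed simp
    then show ?thesis by (simp add: mult.commute)
  qed
  then have "(LINT x|lborel. f' x) = (LINT x|lborel. f (x + 1) - f x)"
    unfolding swap[symmetric] by simp
  also have "\<dots> = 0"
    using shift[OF f, of 1] f by (simp add: has_bochner_integral_iff)
  finally show ?thesis .
qed

lemma pow_div_fact_le_exp:
  fixes x :: real
  assumes "x \<ge> 0"
  shows "x ^ m / fact m \<le> exp x"
proof -
  have "(\<Sum>n\<in>{m}. x ^ n /\<^sub>R fact n) \<le> (\<Sum>n. x ^ n /\<^sub>R fact n)"
    using assms by (intro sum_le_suminf summable_exp_generic) auto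
  then show ?thesis by (simp add: exp_def divide_inverse mult.commute)
qed

lemma square_pow_le_exp:
  fixes \<delta> :: real
  assumes "\<delta> > 0"
  shows "\<exists>C>0. \<forall>z::real. (2 + z\<^sup>2) ^ m \<le> C * exp (\<delta> * z\<^sup>2)"
proof (intro exI conjI allI)
  show "0 < fact m * exp (2 * \<delta>) / \<delta> ^ m"
    using assms by simp
  fix z :: real
  have "(\<delta> * (2 + z\<^sup>2)) ^ m / fact m \<le> exp (\<delta> * (2 + z\<^sup>2))"
    using assms by (intro pow_div_fact_le_exp) auto
  then show "(2 + z\<^sup>2) ^ m \<le> fact m * exp (2 * \<delta>) / \<delta> ^ m * exp (\<delta> * z\<^sup>2)"
    using assms by (simp add: power_mult_distrib) (simp add: field_simps exp_add)
qed

section \<open>Spatial derivatives of the heat kernel\<close>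

text \<open>These are the Hermite polynomials for variance \<open>t\<close>, signed such that multiplication with the
heat kernel gives the \<open>n\<close>-th spatial derivative of the heat kernel.\<close>

fun herm :: "nat \<Rightarrow> real \<Rightarrow> real \<Rightarrow> real" where
  "herm 0 t z = 1"
| "herm (Suc 0) t z = - z / t"
| "herm (Suc (Suc n)) t z = - (z * herm (Suc n) t z + (real n + 1) * herm n t z) / t"

definition heat_kernel :: "nat \<Rightarrow> real \<Rightarrow> real \<Rightarrow> real" where
  "heat_kernel n t z = herm n t z * (exp (- z\<^sup>2 / (2 * t)) / sqrt (2 * pi * t))"

lemma DERIV_herm_z: "(herm n t has_real_derivative - real n / t * herm (n - 1) t z) (at z)"
proof (induction n t z rule: herm.induct)
  case (1 t z)
  have "herm 0 t = (\<lambda>_. 1)" by (rule ext) simp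
  then show ?case by simp
next
  case (2 t z)
  have eq: "herm (Suc 0) t = (\<lambda>z. - z / t)" by (rule ext) simp
  have "((\<lambda>z. - z / t) has_real_derivative - 1 / t) (at z)"
    by (rule DERIV_cdivide) (auto intro!: derivative_eq_intros)
  then show ?case unfolding eq by simp
next
  case (3 n t z)
  have eq: "herm (Suc (Suc n)) t = (\<lambda>z. - (z * herm (Suc n) t z + (real n + 1) * herm n t z) / t)"
    by (rule ext) simp
  have rec: "z * herm n t z + real n * herm (n - 1) t z = - t * herm (Suc n) t z" if "t \<noteq> 0"
    using that by (cases n) (simp_all add: field_simps)
  show ?case
  proof (cases "t = 0")
    case True
    then show ?thesis unfolding eq by simp
  next
    case False
    have "((\<lambda>z. - (z * herm (Suc n) t z + (real n + 1) * herm n t z) / t) has_real_derivative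
        - (herm (Suc n) t z + z * (- real (Suc n) / t * herm n t z)
            + (real n + 1) * (- real n / t * herm (n - 1) t z)) / t) (at z)"
      using 3 False by (auto intro!: derivative_eq_intros simp: mult_ac simp del: herm.simps)
    also have "- (herm (Suc n) t z + z * (- real (Suc n) / t * herm n t z)
            + (real n + 1) * (- real n / t * herm (n - 1) t z)) / t
        = - (herm (Suc n) t z - (real n + 1) / t * (z * herm n t z + real n * herm (n - 1) t z)) / t"
      using False by (simp add: field_simps)
    also have "\<dots> = - real (Suc (Suc n)) / t * herm (Suc n) t z"
      unfolding rec[OF False] using False by (simp add: field_simps)
    finally show ?thesis unfolding eq by simp
  qed
qed

lemma herm_Suc: "t \<noteq> 0 \<Longrightarrow> herm (Suc n) t z = - (z * herm n t z + real n * herm (n - 1) t z) / t"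
  by (cases n) (simp_all add: field_simps)

lemma DERIV_herm_t:
  assumes "t \<noteq> 0"
  shows "((\<lambda>t. herm n t z) has_real_derivative
    (real n * z * herm (n - 1) t z / t - real n * herm n t z) / (2 * t)) (at t)"
  using assms
proof (induction n t z rule: herm.induct)
  case (1 t z)
  then show ?case by simp
next
  case (2 t z)
  then show ?case by (auto intro!: derivative_eq_intros simp: field_simps power2_eq_square)
next
  case (3 n t z)
  have "((\<lambda>t. - (z * herm (Suc n) t z + (real n + 1) * herm n t z) / t) has_real_derivative
     (- (z * ((real (Suc n) * z * herm n t z / t - real (Suc n) * herm (Suc n) t z) / (2 * t))
        + (real n + 1) * ((real n * z * herm (n - 1) t z / t - real n * herm n t z) / (2 * t))) * t
       + (z * herm (Suc n) t z + (real n + 1) * herm n t z)) / (t * t)) (at t)"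
    using 3 by (auto intro!: derivative_eq_intros simp: mult_ac simp del: herm.simps)
  also have "(- (z * ((real (Suc n) * z * herm n t z / t - real (Suc n) * herm (Suc n) t z) / (2 * t))
        + (real n + 1) * ((real n * z * herm (n - 1) t z / t - real n * herm n t z) / (2 * t))) * t
       + (z * herm (Suc n) t z + (real n + 1) * herm n t z)) / (t * t)
     = (real (Suc (Suc n)) * z * herm (Suc n) t z / t - real (Suc (Suc n)) * herm (Suc (Suc n)) t z) / (2 * t)"
  proof -
    have a: "real n * herm (n - 1) t z = - t * herm (Suc n) t z - z * herm n t z"
      using herm_Suc[OF 3(3), of n z] 3(3) by (simp add: field_simps)
    have "(- (z * ((real (Suc n) * z * herm n t z / t - real (Suc n) * herm (Suc n) t z) / (2 * t))
        + (real n + 1) * ((z * (real n * herm (n - 1) t z) / t - real n * herm n t z) / (2 * t))) * t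
       + (z * herm (Suc n) t z + (real n + 1) * herm n t z)) / (t * t)
     = (real (Suc (Suc n)) * z * herm (Suc n) t z / t - real (Suc (Suc n)) * herm (Suc (Suc n)) t z) / (2 * t)"
      unfolding a using 3(3) by (simp add: field_simps)
    then show ?thesis by (simp add: algebra_simps)
  qed
  finally show ?case by simp
qed

lemma DERIV_gauss_z:
  "((\<lambda>z. exp (- z\<^sup>2 / (2 * t)) / c) has_real_derivative - z / t * (exp (- z\<^sup>2 / (2 * t)) / c)) (at z)"
  by (cases "t = 0"; cases "c = 0") (auto intro!: derivative_eq_intros simp: field_simps)

lemma DERIV_gauss_t:
  assumes "t > 0"
  shows "((\<lambda>t. exp (- z\<^sup>2 / (2 * t)) / sqrt (2 * pi * t)) has_real_derivative
    (z\<^sup>2 / (2 * t\<^sup>2) - 1 / (2 * t)) * (exp (- z\<^sup>2 / (2 * t)) / sqrt (2 * pi * t))) (at t)"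
proof -
  define r where "r = sqrt (2 * pi * t)"
  have r: "r > 0" "r * r = 2 * pi * t" using assms by (auto simp: r_def)
  have s: "((\<lambda>t. sqrt (2 * pi * t)) has_real_derivative pi / r) (at t)"
    unfolding r_def using assms less_not_sym[OF mult_pos_pos[OF pi_gt_zero assms]]
    by (auto intro!: derivative_eq_intros simp: field_simps)
  have e: "((\<lambda>t. exp (- z\<^sup>2 / (2 * t))) has_real_derivative exp (- z\<^sup>2 / (2 * t)) * (z\<^sup>2 / (2 * t\<^sup>2))) (at t)"
    using assms by (auto intro!: derivative_eq_intros simp: field_simps power2_eq_square)
  have "((\<lambda>t. exp (- z\<^sup>2 / (2 * t)) / sqrt (2 * pi * t)) has_real_derivative
     (exp (- z\<^sup>2 / (2 * t)) * (z\<^sup>2 / (2 * t\<^sup>2)) * r - exp (- z\<^sup>2 / (2 * t)) * (pi / r)) / (r * r)) (at t)"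
    using DERIV_divide[OF e s] r assms by (simp add: r_def)
  also have "(exp (- z\<^sup>2 / (2 * t)) * (z\<^sup>2 / (2 * t\<^sup>2)) * r - exp (- z\<^sup>2 / (2 * t)) * (pi / r)) / (r * r)
     = (z\<^sup>2 / (2 * t\<^sup>2) - pi / (r * r)) * (exp (- z\<^sup>2 / (2 * t)) / r)"
    using r(1) by (simp add: field_simps)
  also have "pi / (r * r) = 1 / (2 * t)"
    unfolding r(2) using assms by simp
  finally show ?thesis by (simp add: r_def)
qed

lemma DERIV_heat_kernel_z:
  assumes "t > 0"
  shows "(heat_kernel n t has_real_derivative heat_kernel (Suc n) t z) (at z)"
proof -
  have "((\<lambda>z. herm n t z * (exp (- z\<^sup>2 / (2 * t)) / sqrt (2 * pi * t))) has_real_derivative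
     (- real n / t * herm (n - 1) t z) * (exp (- z\<^sup>2 / (2 * t)) / sqrt (2 * pi * t))
     + (- z / t * (exp (- z\<^sup>2 / (2 * t)) / sqrt (2 * pi * t))) * herm n t z) (at z)"
    by (intro DERIV_mult DERIV_herm_z DERIV_gauss_z)
  also have "(- real n / t * herm (n - 1) t z) * (exp (- z\<^sup>2 / (2 * t)) / sqrt (2 * pi * t))
     + (- z / t * (exp (- z\<^sup>2 / (2 * t)) / sqrt (2 * pi * t))) * herm n t z = heat_kernel (Suc n) t z"
    using assms by (simp add: heat_kernel_def herm_Suc field_simps)
  also have "(\<lambda>z. herm n t z * (exp (- z\<^sup>2 / (2 * t)) / sqrt (2 * pi * t))) = heat_kernel n t"
    by (simp add: heat_kernel_def fun_eq_iff)
  finally show ?thesis .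
qed

lemma DERIV_heat_kernel_t:
  assumes "t > 0"
  shows "((\<lambda>t. heat_kernel n t z) has_real_derivative heat_kernel (Suc (Suc n)) t z / 2) (at t)"
proof -
  define G where "G = exp (- z\<^sup>2 / (2 * t)) / sqrt (2 * pi * t)"
  have "((\<lambda>t. heat_kernel n t z) has_real_derivative
    ((real n * z * herm (n - 1) t z / t - real n * herm n t z) / (2 * t)) * G
     + ((z\<^sup>2 / (2 * t\<^sup>2) - 1 / (2 * t)) * G) * herm n t z) (at t)"
    unfolding heat_kernel_def G_def using assms by (intro DERIV_mult DERIV_herm_t DERIV_gauss_t) auto
  also have "((real n * z * herm (n - 1) t z / t - real n * herm n t z) / (2 * t)) * G
     + ((z\<^sup>2 / (2 * t\<^sup>2) - 1 / (2 * t)) * G) * herm n t z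
     = - (z * (- (z * herm n t z + real n * herm (n - 1) t z) / t) + (real n + 1) * herm n t z) / t / 2 * G"
    using assms by (simp add: field_simps power2_eq_square)
  also have "\<dots> = heat_kernel (Suc (Suc n)) t z / 2"
    using assms unfolding herm_Suc[OF less_imp_neq[OF assms, symmetric], of n z, symmetric]
    by (simp add: heat_kernel_def G_def)
  finally show ?thesis .
qed

lemma continuous_on_heat_kernel: "t > 0 \<Longrightarrow> continuous_on UNIV (heat_kernel n t)"
  by (rule DERIV_continuous_on) (rule DERIV_heat_kernel_z[THEN has_field_derivative_at_within])

lemma abs_le_2_plus_square: "\<bar>z\<bar> \<le> 2 + z\<^sup>2" for z :: real
proof -
  have "0 \<le> (\<bar>z\<bar> - 1)\<^sup>2" by simp
  then show ?thesis using zero_le_power2[of z] by (simp add: power2_diff)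
qed

text \<open>The base \<open>2 + z\<^sup>2\<close> dominates both \<open>1\<close> and \<open>\<bar>z\<bar>\<close>, so the recursion raises the power by one
in each step and the constant depends on the lower bound for \<open>t\<close> only.\<close>

lemma herm_bound:
  assumes "a > 0"
  shows "\<exists>A>0. \<forall>t\<ge>a. \<forall>z. \<bar>herm n t z\<bar> \<le> A * (2 + z\<^sup>2) ^ n"
proof (induction n rule: induct_nat_012)
  case 0
  show ?case by (intro exI[of _ 1]) auto
next
  case 1
  have "\<bar>z\<bar> / t \<le> 1 / a * (2 + z\<^sup>2)" if "t \<ge> a" for t z :: real
  proof -
    have "\<bar>z\<bar> \<le> 2 + z\<^sup>2" by (rule abs_le_2_plus_square)
    then have "\<bar>z\<bar> / t \<le> (2 + z\<^sup>2) / a"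
      using assms that by (intro frac_le) auto
    then show ?thesis by simp
  qed
  then show ?case using assms by (intro exI[of _ "1 / a"]) auto
next
  case (ge2 n)
  from ge2(1) obtain A where A: "A > 0" "\<And>t z. t \<ge> a \<Longrightarrow> \<bar>herm n t z\<bar> \<le> A * (2 + z\<^sup>2) ^ n" by blast
  from ge2(2) obtain B where B: "B > 0" "\<And>t z. t \<ge> a \<Longrightarrow> \<bar>herm (Suc n) t z\<bar> \<le> B * (2 + z\<^sup>2) ^ Suc n" by blast
  have "\<bar>herm (Suc (Suc n)) t z\<bar> \<le> (B + (real n + 1) * A) / a * (2 + z\<^sup>2) ^ Suc (Suc n)" if t: "t \<ge> a" for t z
  proof -
    have z: "\<bar>z\<bar> \<le> 2 + z\<^sup>2" by (rule abs_le_2_plus_square)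
    have "\<bar>z * herm (Suc n) t z\<bar> \<le> (2 + z\<^sup>2) * (B * (2 + z\<^sup>2) ^ Suc n)"
      unfolding abs_mult using z B t by (intro mult_mono) auto
    moreover have "\<bar>(real n + 1) * herm n t z\<bar> \<le> (real n + 1) * (A * (2 + z\<^sup>2) ^ n)"
      unfolding abs_mult using A t by (intro mult_mono) auto
    moreover have "(real n + 1) * (A * (2 + z\<^sup>2) ^ n) \<le> (real n + 1) * (A * (2 + z\<^sup>2) ^ Suc (Suc n))"
      using A(1) by (intro mult_left_mono power_increasing) (auto simp: add_increasing2)
    ultimately have "\<bar>z * herm (Suc n) t z + (real n + 1) * herm n t z\<bar> \<le> (B + (real n + 1) * A) * (2 + z\<^sup>2) ^ Suc (Suc n)"
      by (simp add: algebra_simps)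
    then have "\<bar>z * herm (Suc n) t z + (real n + 1) * herm n t z\<bar> / t \<le> (B + (real n + 1) * A) * (2 + z\<^sup>2) ^ Suc (Suc n) / a"
      using t assms by (intro frac_le) auto
    moreover have "\<bar>herm (Suc (Suc n)) t z\<bar> = \<bar>z * herm (Suc n) t z + (real n + 1) * herm n t z\<bar> / t"
      using t assms by (simp only: herm.simps abs_divide abs_minus_cancel)
    ultimately show ?thesis by simp
  qed
  moreover have "(B + (real n + 1) * A) / a > 0"
    using A(1) B(1) assms by (simp add: add_pos_pos)
  ultimately show ?case by blast
qed

text \<open>A power of a polynomial is absorbed by passing from the time \<open>t\<close> to a strictly later time
\<open>b'\<close>.  Arbitrary powers \<open>N\<close> are needed for the bound \<open>heat_bound\<close> below.\<close>

lemma herm_power_gauss_le: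
  assumes "0 < a" "b < b'"
  shows "\<exists>C>0. \<forall>t z. a \<le> t \<longrightarrow> t \<le> b \<longrightarrow> \<bar>herm n t z\<bar> ^ N * exp (- z\<^sup>2 / (2 * t)) \<le> C * exp (- z\<^sup>2 / (2 * b'))"
proof (cases "b > 0")
  case False
  then show ?thesis using assms by (intro exI[of _ 1]) auto
next
  case b: True
  define \<delta> where "\<delta> = 1 / (2 * b) - 1 / (2 * b')"
  have \<delta>: "\<delta> > 0" using b assms by (simp add: \<delta>_def field_simps)
  from herm_bound[OF assms(1)] obtain A where A: "A > 0" "\<And>t z. t \<ge> a \<Longrightarrow> \<bar>herm n t z\<bar> \<le> A * (2 + z\<^sup>2) ^ n"
    by blast
  from square_pow_le_exp[OF \<delta>] obtain C where C: "C > 0" "\<And>z. (2 + z\<^sup>2) ^ (n * N) \<le> C * exp (\<delta> * z\<^sup>2)"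
    by blast
  have "\<bar>herm n t z\<bar> ^ N * exp (- z\<^sup>2 / (2 * t)) \<le> (A ^ N * C) * exp (- z\<^sup>2 / (2 * b'))" if t: "a \<le> t" "t \<le> b" for t z
  proof -
    have "\<bar>herm n t z\<bar> ^ N \<le> (A * (2 + z\<^sup>2) ^ n) ^ N"
      using A t by (intro power_mono) auto
    also have "\<dots> = A ^ N * (2 + z\<^sup>2) ^ (n * N)"
      by (simp add: power_mult_distrib power_mult)
    also have "\<dots> \<le> A ^ N * (C * exp (\<delta> * z\<^sup>2))"
      using A C by (intro mult_left_mono) auto
    finally have 1: "\<bar>herm n t z\<bar> ^ N \<le> A ^ N * (C * exp (\<delta> * z\<^sup>2))" .
    have "z\<^sup>2 / (2 * b) \<le> z\<^sup>2 / (2 * t)"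
      using t assms(1) by (intro divide_left_mono) auto
    then have 2: "exp (- z\<^sup>2 / (2 * t)) \<le> exp (- z\<^sup>2 / (2 * b))"
      by simp
    have "\<bar>herm n t z\<bar> ^ N * exp (- z\<^sup>2 / (2 * t)) \<le> (A ^ N * (C * exp (\<delta> * z\<^sup>2))) * exp (- z\<^sup>2 / (2 * b))"
      using 1 2 A C by (intro mult_mono) auto
    also have "\<dots> = A ^ N * C * exp (\<delta> * z\<^sup>2 + (- z\<^sup>2 / (2 * b)))"
      by (simp only: exp_add mult.assoc)
    also have "\<delta> * z\<^sup>2 + (- z\<^sup>2 / (2 * b)) = - z\<^sup>2 / (2 * b')"
      by (simp add: \<delta>_def algebra_simps)
    finally show ?thesis .
  qed
  then show ?thesis using A C by (intro exI[of _ "A ^ N * C"]) auto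
qed

lemma heat_kernel_bounded:
  assumes "0 < a"
  shows "\<exists>C>0. \<forall>t z. a \<le> t \<longrightarrow> t \<le> b \<longrightarrow> \<bar>heat_kernel n t z\<bar> \<le> C"
proof -
  from herm_power_gauss_le[OF assms, of b "b + 1" n 1] obtain C where
    C: "C > 0" "\<And>t z. a \<le> t \<Longrightarrow> t \<le> b \<Longrightarrow> \<bar>herm n t z\<bar> * exp (- z\<^sup>2 / (2 * t)) \<le> C * exp (- z\<^sup>2 / (2 * (b + 1)))"
    by auto
  have "\<bar>heat_kernel n t z\<bar> \<le> C / sqrt (2 * pi * a)" if t: "a \<le> t" "t \<le> b" for t z
  proof -
    have "exp (- z\<^sup>2 / (2 * (b + 1))) \<le> 1"
      using assms t by simp
    then have "C * exp (- z\<^sup>2 / (2 * (b + 1))) \<le> C * 1"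
      using C(1) by (intro mult_left_mono) auto
    then have "\<bar>herm n t z\<bar> * exp (- z\<^sup>2 / (2 * t)) \<le> C"
      using C(2)[OF t, of z] by linarith
    moreover have "sqrt (2 * pi * a) \<le> sqrt (2 * pi * t)"
      using t assms by (intro real_sqrt_le_mono mult_left_mono) auto
    ultimately have "\<bar>herm n t z\<bar> * exp (- z\<^sup>2 / (2 * t)) / sqrt (2 * pi * t) \<le> C / sqrt (2 * pi * a)"
      using C(1) assms t by (intro frac_le) auto
    then show ?thesis using t assms by (simp add: heat_kernel_def abs_mult)
  qed
  then show ?thesis using C(1) assms by (intro exI[of _ "C / sqrt (2 * pi * a)"]) auto
qed

section \<open>The heat evolution of a density\<close>

text \<open>This elementary substitute for Hoelder's inequality has a free weight \<open>\<rho>\<close>, which will be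
optimised pointwise.\<close>

lemma le_weighted_power:
  fixes h \<rho> :: real
  assumes "h \<ge> 0" "\<rho> > 0"
  shows "h \<le> \<rho> + h ^ Suc m / \<rho> ^ m"
proof (cases "h \<le> \<rho>")
  case False
  then have "\<rho> ^ m \<le> h ^ m" using assms by (intro power_mono) auto
  then have "h * \<rho> ^ m \<le> h * h ^ m" using assms by (intro mult_left_mono) auto
  then have "h \<le> h ^ Suc m / \<rho> ^ m" using assms by (simp add: field_simps)
  then show ?thesis using assms by simp
qed (use assms in \<open>simp add: add_increasing2\<close>)

lemma heat_kernel_0: "heat_kernel 0 t z = exp (- z\<^sup>2 / (2 * t)) / sqrt (2 * pi * t)"
  by (simp add: heat_kernel_def)

lemma heat_kernel_eq: "heat_kernel n t z = herm n t z * heat_kernel 0 t z"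
  by (simp add: heat_kernel_def)

lemma heat_kernel_0_pos: "t > 0 \<Longrightarrow> heat_kernel 0 t z > 0"
  by (simp add: heat_kernel_0)

lemma heat_kernel_0_eq_normal_density:
  "t > 0 \<Longrightarrow> heat_kernel 0 t (x - y) = normal_density y (sqrt t) x"
  by (simp add: heat_kernel_0 normal_density_def)

lemma heat_kernel_0_commute: "heat_kernel 0 t (x - y) = heat_kernel 0 t (y - x)"
  by (simp add: heat_kernel_0 power2_commute)

lemma heat_kernel_0_mono:
  assumes "0 < t" "t \<le> t'"
  shows "heat_kernel 0 t z \<le> sqrt (t' / t) * heat_kernel 0 t' z"
proof -
  have "z\<^sup>2 / (2 * t') \<le> z\<^sup>2 / (2 * t)"
    using assms by (intro divide_left_mono) auto
  then have "exp (- z\<^sup>2 / (2 * t)) / sqrt (2 * pi * t) \<le> exp (- z\<^sup>2 / (2 * t')) / sqrt (2 * pi * t)"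
    using assms by (intro divide_right_mono) auto
  also have "\<dots> = sqrt (t' / t) * (exp (- z\<^sup>2 / (2 * t')) / sqrt (2 * pi * t'))"
    using assms by (simp add: real_sqrt_mult real_sqrt_divide field_simps)
  finally show ?thesis by (simp add: heat_kernel_0)
qed

lemma borel_measurable_heat_kernel[measurable]: "t > 0 \<Longrightarrow> heat_kernel n t \<in> borel_measurable borel"
  by (intro borel_measurable_continuous_onI continuous_on_heat_kernel)

locale heat_density =
  fixes g :: "real \<Rightarrow> real"
  assumes g_nonneg: "g x \<ge> 0" and g_int: "integrable lborel g" and g_total: "(LINT x|lborel. g x) = 1"
    and g_cont: "continuous_on UNIV g" and g_bdd: "bounded (range g)"
begin

text \<open>For \<open>n = 0\<close> this is the Gaussian convolution that solves the Cauchy problem, for larger \<open>n\<close> it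
is the \<open>n\<close>-th spatial derivative of the solution (\<open>DERIV_heat_x\<close>).\<close>

definition heat :: "nat \<Rightarrow> real \<Rightarrow> real \<Rightarrow> real" where
  "heat n t x = (LINT y|lborel. g y * heat_kernel n t (x - y))"

lemma g_meas[measurable]: "g \<in> borel_measurable borel"
  using g_int by auto

lemma heat_integrand:
  assumes "t > 0"
  shows "integrable lborel (\<lambda>y. g y * heat_kernel n t (x - y))"
proof -
  obtain C where C: "\<And>z. \<bar>heat_kernel n t z\<bar> \<le> C"
    using heat_kernel_bounded[OF assms, of t n] by auto
  show ?thesis
  proof (rule Bochner_Integration.integrable_bound)
    show "integrable lborel (\<lambda>y. C * g y)" using g_int by simp
    show "(\<lambda>y. g y * heat_kernel n t (x - y)) \<in> borel_measurable lborel"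
      using assms by measurable
    show "AE y in lborel. norm (g y * heat_kernel n t (x - y)) \<le> norm (C * g y)"
    proof (rule AE_I2)
      fix y
      have "C \<ge> 0" using C[of 0] by linarith
      have "g y * \<bar>heat_kernel n t (x - y)\<bar> \<le> g y * C"
        using C g_nonneg by (intro mult_left_mono) auto
      then show "norm (g y * heat_kernel n t (x - y)) \<le> norm (C * g y)"
        using \<open>C \<ge> 0\<close> g_nonneg[of y] by (simp add: abs_mult mult.commute)
    qed
  qed
qed

lemma DERIV_heat_x:
  assumes t: "t > 0"
  shows "(heat n t has_real_derivative heat (Suc n) t x) (at x)"
proof -
  obtain C where C: "\<And>z. \<bar>heat_kernel (Suc n) t z\<bar> \<le> C"
    using heat_kernel_bounded[OF assms, of t "Suc n"] by auto
  have "((\<lambda>x. LINT y|lborel. g y * heat_kernel n t (x - y)) has_real_derivative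
      (LINT y|lborel. g y * heat_kernel (Suc n) t (x - y))) (at x)"
  proof (rule has_real_derivative_integral[where a = "x - 1" and b = "x + 1" and h = "\<lambda>y. C * g y"])
    show "((\<lambda>x. g y * heat_kernel n t (x - y)) has_real_derivative g y * heat_kernel (Suc n) t (x - y)) (at x)" for x y
    proof -
      have d: "((\<lambda>x. x - y) has_real_derivative 1) (at x)"
        by (auto intro!: derivative_eq_intros)
      show ?thesis
        using DERIV_cmult[OF DERIV_chain'[OF d DERIV_heat_kernel_z[OF t, of n "x - y"]], of "g y"] by simp
    qed
    show "\<bar>g y * heat_kernel (Suc n) t (x - y)\<bar> \<le> C * g y" for x y
    proof -
      have "g y * \<bar>heat_kernel (Suc n) t (x - y)\<bar> \<le> g y * C"
        using C g_nonneg by (intro mult_left_mono) auto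
      then show ?thesis using g_nonneg[of y] by (simp add: abs_mult mult.commute)
    qed
    show "(\<lambda>y. g y * heat_kernel (Suc n) t (x - y)) \<in> borel_measurable lborel"
      using t by measurable
  qed (use t g_int heat_integrand in auto)
  then show ?thesis by (simp add: heat_def[abs_def])
qed

lemma DERIV_heat_t:
  assumes t: "t > 0"
  shows "((\<lambda>t. heat n t x) has_real_derivative heat (Suc (Suc n)) t x / 2) (at t)"
proof -
  obtain C where C: "\<And>s z. t / 2 \<le> s \<Longrightarrow> s \<le> 2 * t \<Longrightarrow> \<bar>heat_kernel (Suc (Suc n)) s z\<bar> \<le> C"
    using heat_kernel_bounded[of "t / 2" "2 * t" "Suc (Suc n)"] t by auto
  have "((\<lambda>t. LINT y|lborel. g y * heat_kernel n t (x - y)) has_real_derivative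
      (LINT y|lborel. g y * (heat_kernel (Suc (Suc n)) t (x - y) / 2))) (at t)"
  proof (rule has_real_derivative_integral[where a = "t / 2" and b = "2 * t" and h = "\<lambda>y. C * g y"])
    show "((\<lambda>s. g y * heat_kernel n s (x - y)) has_real_derivative g y * (heat_kernel (Suc (Suc n)) s (x - y) / 2)) (at s)"
      if "t / 2 < s" for s y
      using that t by (intro DERIV_cmult DERIV_heat_kernel_t) auto
    show "\<bar>g y * (heat_kernel (Suc (Suc n)) s (x - y) / 2)\<bar> \<le> C * g y" if "t / 2 < s" "s < 2 * t" for s y
    proof -
      have "\<bar>heat_kernel (Suc (Suc n)) s (x - y)\<bar> \<le> C" using C that by simp
      then have "g y * (\<bar>heat_kernel (Suc (Suc n)) s (x - y)\<bar> / 2) \<le> g y * C"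
        using g_nonneg by (intro mult_left_mono) auto
      then show ?thesis using g_nonneg[of y] by (simp add: abs_mult mult.commute)
    qed
    show "(\<lambda>y. g y * (heat_kernel (Suc (Suc n)) t (x - y) / 2)) \<in> borel_measurable lborel"
      using t by measurable
  qed (use t g_int heat_integrand in auto)
  also have "(LINT y|lborel. g y * (heat_kernel (Suc (Suc n)) t (x - y) / 2)) = heat (Suc (Suc n)) t x / 2"
    by (simp add: heat_def)
  finally show ?thesis by (simp add: heat_def[abs_def])
qed

lemma continuous_on_heat: "t > 0 \<Longrightarrow> continuous_on UNIV (heat n t)"
  by (rule DERIV_continuous_on) (rule DERIV_heat_x[THEN has_field_derivative_at_within])

lemma heat_0_pos:
  assumes t: "t > 0"
  shows "heat 0 t x > 0"
proof -
  have "heat 0 t x \<ge> 0" unfolding heat_def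
    by (intro integral_nonneg_AE AE_I2 mult_nonneg_nonneg g_nonneg less_imp_le heat_kernel_0_pos t)
  moreover have "heat 0 t x \<noteq> 0"
  proof
    assume "heat 0 t x = 0"
    moreover have "0 \<le> g y * heat_kernel 0 t (x - y)" for y
      by (intro mult_nonneg_nonneg g_nonneg less_imp_le heat_kernel_0_pos t)
    ultimately have "AE y in lborel. g y * heat_kernel 0 t (x - y) = 0"
      using integral_nonneg_eq_0_iff_AE[OF heat_integrand[OF t, of 0 x]] by (simp add: heat_def)
    then have "AE y in lborel. g y = 0"
      by eventually_elim (use heat_kernel_0_pos[OF t] in \<open>auto simp: less_imp_neq[symmetric]\<close>)
    then have "(LINT y|lborel. g y) = 0"
      by (rule integral_eq_zero_AE)
    then show False using g_total by simp
  qed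
  ultimately show ?thesis by simp
qed

lemma heat_0_mono:
  assumes "0 < t" "t \<le> t'"
  shows "heat 0 t x \<le> sqrt (t' / t) * heat 0 t' x"
proof -
  have "heat 0 t x \<le> (LINT y|lborel. sqrt (t' / t) * (g y * heat_kernel 0 t' (x - y)))"
    unfolding heat_def
  proof (intro integral_mono heat_integrand integrable_mult_right)
    fix y
    have "g y * heat_kernel 0 t (x - y) \<le> g y * (sqrt (t' / t) * heat_kernel 0 t' (x - y))"
      using assms by (intro mult_left_mono heat_kernel_0_mono g_nonneg)
    then show "g y * heat_kernel 0 t (x - y) \<le> sqrt (t' / t) * (g y * heat_kernel 0 t' (x - y))"
      by (simp add: mult_ac)
  qed (use assms in auto)
  then show ?thesis by (simp add: heat_def)
qed

lemma heat_kernel_0_integral: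
  assumes "t > 0"
  shows "integrable lborel (\<lambda>x. heat_kernel 0 t (x - y))" "(LINT x|lborel. heat_kernel 0 t (x - y)) = 1"
    "integrable lborel (\<lambda>y. heat_kernel 0 t (x - y))" "(LINT y|lborel. heat_kernel 0 t (x - y)) = 1"
proof -
  show "integrable lborel (\<lambda>x. heat_kernel 0 t (x - y))" "(LINT x|lborel. heat_kernel 0 t (x - y)) = 1" for y
    using assms by (simp_all add: heat_kernel_0_eq_normal_density)
  from this[of x] show "integrable lborel (\<lambda>y. heat_kernel 0 t (x - y))" "(LINT y|lborel. heat_kernel 0 t (x - y)) = 1"
    by (simp_all add: heat_kernel_0_commute[of t x])
qed

lemma heat_0_bounded: "\<exists>B>0. \<forall>t>0. \<forall>x. heat 0 t x \<le> B"
proof -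
  obtain B where B: "B > 0" "\<And>x. \<bar>g x\<bar> \<le> B"
    using g_bdd by (auto simp: bounded_pos)
  have "heat 0 t x \<le> B" if t: "t > 0" for t x
  proof -
    have "heat 0 t x \<le> (LINT y|lborel. B * heat_kernel 0 t (x - y))"
      unfolding heat_def using heat_kernel_0_integral[OF t] heat_kernel_0_pos[OF t] B
      by (intro integral_mono heat_integrand t mult_right_mono)
         (auto simp: less_imp_le abs_le_iff)
    then show ?thesis using heat_kernel_0_integral[OF t] by simp
  qed
  then show ?thesis using B by blast
qed

lemma integrable_heat_0:
  assumes t: "t > 0"
  shows "integrable lborel (heat 0 t)"
proof -
  interpret lborel_pair: pair_sigma_finite lborel lborel ..
  have "integrable (lborel \<Otimes>\<^sub>M lborel) (\<lambda>(y, x). g y * heat_kernel 0 t (x - y))"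
  proof (rule lborel_pair.Fubini_integrable)
    show "(\<lambda>(y, x). g y * heat_kernel 0 t (x - y)) \<in> borel_measurable (lborel \<Otimes>\<^sub>M lborel)"
      using t by measurable
    have "(LINT x|lborel. norm (g y * heat_kernel 0 t (x - y))) = g y" for y
      using g_nonneg[of y] heat_kernel_0_pos[OF t] heat_kernel_0_integral[OF t]
      by (simp add: abs_mult less_imp_le)
    then show "integrable lborel (\<lambda>y. LINT x|lborel. norm (case (y, x) of (y, x) \<Rightarrow> g y * heat_kernel 0 t (x - y)))"
      using g_int by simp
    show "AE y in lborel. integrable lborel (\<lambda>x. case (y, x) of (y, x) \<Rightarrow> g y * heat_kernel 0 t (x - y))"
      using heat_kernel_0_integral[OF t] by simp
  qed
  then have "integrable lborel (\<lambda>x. LINT y|lborel. g y * heat_kernel 0 t (x - y))"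
    by (rule lborel_pair.integrable_snd)
  then show ?thesis by (simp add: heat_def[abs_def])
qed

text \<open>The derivatives of the solution are almost bounded by the solution itself: the loss is an
arbitrarily small power of the quotient of the solution at a later time and at the present
time.  No bound without loss holds, since already for a Gaussian the quotient \<open>u\<^sub>x / u\<close> grows
linearly in \<open>x\<close>.  The bound follows from \<open>le_weighted_power\<close> with the weight \<open>\<rho>\<close> below, which
makes its two terms equal in size.\<close>

lemma heat_bound:
  assumes "0 < a" "a \<le> b" "b < b'"
  shows "\<exists>C. \<forall>t x. a \<le> t \<longrightarrow> t \<le> b \<longrightarrow>
    \<bar>heat n t x\<bar> \<le> C * heat 0 t x * (heat 0 b' x / heat 0 t x) powr (1 / real (Suc m))"
proof -
  from herm_power_gauss_le[OF assms(1,3), of n "Suc m"] obtain C where C: "C > 0"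
    "\<And>t z. a \<le> t \<Longrightarrow> t \<le> b \<Longrightarrow> \<bar>herm n t z\<bar> ^ Suc m * exp (- z\<^sup>2 / (2 * t)) \<le> C * exp (- z\<^sup>2 / (2 * b'))"
    by blast
  define D where "D = C * sqrt (b' / a)"
  have D: "D > 0" using C assms by (simp add: D_def)
  have "\<bar>heat n t x\<bar> \<le> (1 + D) * heat 0 t x * (heat 0 b' x / heat 0 t x) powr (1 / real (Suc m))"
    if t: "a \<le> t" "t \<le> b" for t x
  proof -
    have t0: "t > 0" "b' > 0" using t assms by auto
    \<comment> \<open>The two terms of the pointwise bound integrate to \<open>\<rho>\<close> times the solution at time \<open>t\<close> and to
      a multiple of \<open>\<rho>\<close> to the power \<open>- m\<close> times the solution at time \<open>b'\<close>; this weight balances them.\<close>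
    define \<rho> where "\<rho> = (heat 0 b' x / heat 0 t x) powr (1 / real (Suc m))"
    have u: "heat 0 t x > 0" "heat 0 b' x > 0" using heat_0_pos t0 by auto
    have \<rho>: "\<rho> > 0" using u by (simp add: \<rho>_def)
    have pow: "\<rho> ^ Suc m = heat 0 b' x / heat 0 t x"
      using u by (simp add: \<rho>_def powr_realpow[symmetric] powr_powr del: power_Suc)
    have pt: "\<bar>heat_kernel n t z\<bar> \<le> \<rho> * heat_kernel 0 t z + D / \<rho> ^ m * heat_kernel 0 b' z" for z
    proof -
      have "\<bar>herm n t z\<bar> ^ Suc m * heat_kernel 0 t z = (\<bar>herm n t z\<bar> ^ Suc m * exp (- z\<^sup>2 / (2 * t))) / sqrt (2 * pi * t)"
        by (simp add: heat_kernel_0)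
      also have "\<dots> \<le> C * exp (- z\<^sup>2 / (2 * b')) / sqrt (2 * pi * t)"
        using C(2)[OF t] t0 by (intro divide_right_mono) auto
      also have "\<dots> \<le> C * exp (- z\<^sup>2 / (2 * b')) / sqrt (2 * pi * a)"
        using C(1) t assms(1) by (intro divide_left_mono real_sqrt_le_mono mult_left_mono) auto
      also have "\<dots> = D * heat_kernel 0 b' z"
        using assms t0 by (simp add: D_def heat_kernel_0 real_sqrt_mult real_sqrt_divide field_simps)
      finally have 1: "\<bar>herm n t z\<bar> ^ Suc m * heat_kernel 0 t z \<le> D * heat_kernel 0 b' z" .
      have "\<bar>heat_kernel n t z\<bar> = \<bar>herm n t z\<bar> * heat_kernel 0 t z"
        unfolding heat_kernel_eq[of n] abs_mult using heat_kernel_0_pos[OF t0(1), of z] by simp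
      also have "\<dots> \<le> (\<rho> + \<bar>herm n t z\<bar> ^ Suc m / \<rho> ^ m) * heat_kernel 0 t z"
        using le_weighted_power[of "\<bar>herm n t z\<bar>" \<rho> m] \<rho> heat_kernel_0_pos[OF t0(1), of z]
        by (intro mult_right_mono) auto
      also have "\<dots> = \<rho> * heat_kernel 0 t z + (\<bar>herm n t z\<bar> ^ Suc m * heat_kernel 0 t z) / \<rho> ^ m"
        by (simp add: algebra_simps)
      also have "\<dots> \<le> \<rho> * heat_kernel 0 t z + (D * heat_kernel 0 b' z) / \<rho> ^ m"
        using 1 \<rho> by (intro add_left_mono divide_right_mono) auto
      finally show ?thesis by simp
    qed
    have "\<bar>heat n t x\<bar> \<le> (LINT y|lborel. \<bar>g y * heat_kernel n t (x - y)\<bar>)"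
      unfolding heat_def by (rule integral_abs_bound)
    also have "\<dots> \<le> (LINT y|lborel. \<rho> * (g y * heat_kernel 0 t (x - y)) + D / \<rho> ^ m * (g y * heat_kernel 0 b' (x - y)))"
    proof (rule integral_mono)
      show "integrable lborel (\<lambda>y. \<bar>g y * heat_kernel n t (x - y)\<bar>)"
        using heat_integrand t0 by auto
      show "integrable lborel (\<lambda>y. \<rho> * (g y * heat_kernel 0 t (x - y)) + D / \<rho> ^ m * (g y * heat_kernel 0 b' (x - y)))"
        using heat_integrand t0 by (intro Bochner_Integration.integrable_add integrable_mult_right) auto
      fix y
      have "g y * \<bar>heat_kernel n t (x - y)\<bar> \<le> g y * (\<rho> * heat_kernel 0 t (x - y) + D / \<rho> ^ m * heat_kernel 0 b' (x - y))"
        by (intro mult_left_mono pt g_nonneg)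
      then show "\<bar>g y * heat_kernel n t (x - y)\<bar> \<le> \<rho> * (g y * heat_kernel 0 t (x - y)) + D / \<rho> ^ m * (g y * heat_kernel 0 b' (x - y))"
        using g_nonneg[of y] by (simp add: abs_mult algebra_simps)
    qed
    also have "\<dots> = \<rho> * heat 0 t x + D / \<rho> ^ m * heat 0 b' x"
      using heat_integrand t0 by (simp add: heat_def)
    also have "\<dots> = \<rho> * heat 0 t x + D / \<rho> ^ m * (\<rho> ^ Suc m * heat 0 t x)"
      unfolding pow using u by simp
    also have "\<dots> = (1 + D) * heat 0 t x * \<rho>"
      using \<rho> by (simp add: field_simps)
    finally show ?thesis unfolding \<rho>_def .
  qed
  then show ?thesis by blast
qed

end

section \<open>Differential polynomials and their moments\<close>

text \<open>A differential polynomial is a list of terms; a term \<open>(c, [k\<^sub>1, ..., k\<^sub>d])\<close> stands for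
\<open>c y\<^sub>k\<^sub>1 \<cdots> y\<^sub>k\<^sub>d\<close>.  Exponents are expressed by repeating an index, so that the product rule is a
list recursion.\<close>

type_synonym dpoly = "(real \<times> nat list) list"

definition peval :: "(nat \<Rightarrow> real) \<Rightarrow> dpoly \<Rightarrow> real" where
  "peval y P = (\<Sum>(c, ks)\<leftarrow>P. c * prod_list (map y ks))"

fun bumps :: "nat \<Rightarrow> nat list \<Rightarrow> nat list list" where
  "bumps d [] = []"
| "bumps d (k # ks) = ((k + d) # ks) # map ((#) k) (bumps d ks)"

text \<open>If every \<open>v\<^sub>k\<close> has derivative \<open>v\<^bsub>k+d\<^esub>\<close>, then \<open>v\<^sub>0\<^sup>\<alpha> P(v\<^sub>1/v\<^sub>0, v\<^sub>2/v\<^sub>0, ...)\<close> has the derivative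
\<open>v\<^sub>0\<^sup>\<alpha>\<close> times \<open>total d \<alpha> P\<close>.  The case \<open>d = 1\<close> is the spatial derivative, and the case
\<open>d = 2\<close> is, by the heat equation, twice the time derivative.  The factor
\<open>\<alpha> - real (length ks)\<close> appears because a product of \<open>m\<close> quotients, taken together with
\<open>v\<^sub>0\<^sup>\<alpha>\<close>, carries the power \<open>v\<^sub>0\<^bsup>\<alpha>-m\<^esup>\<close>.\<close>

fun total :: "nat \<Rightarrow> real \<Rightarrow> dpoly \<Rightarrow> dpoly" where
  "total d \<alpha> [] = []"
| "total d \<alpha> ((c, ks) # P) =
     (c * (\<alpha> - real (length ks)), d # ks) # map (\<lambda>ls. (c, ls)) (bumps d ks) @ total d \<alpha> P"

lemma peval_Nil [simp]: "peval y [] = 0"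
  by (simp add: peval_def)

lemma peval_Cons [simp]: "peval y ((c, ks) # P) = c * prod_list (map y ks) + peval y P"
  by (simp add: peval_def)

lemma peval_append [simp]: "peval y (P @ Q) = peval y P + peval y Q"
  by (simp add: peval_def)

lemma peval_map_const: "peval y (map (\<lambda>ls. (c, ls)) L) = c * (\<Sum>ls\<leftarrow>L. prod_list (map y ls))"
  by (induction L) (simp_all add: algebra_simps)

lemma DERIV_prod_list_quotients:
  fixes v :: "nat \<Rightarrow> real \<Rightarrow> real"
  assumes deriv: "\<And>k. (v k has_real_derivative c * v (k + d) \<tau>) (at \<tau>)" and pos: "v 0 \<tau> \<noteq> 0"
  defines "y \<equiv> \<lambda>\<sigma> k. v k \<sigma> / v 0 \<sigma>"
  shows "((\<lambda>\<sigma>. prod_list (map (y \<sigma>) ks)) has_real_derivative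
    c * ((\<Sum>ls\<leftarrow>bumps d ks. prod_list (map (y \<tau>) ls)) - real (length ks) * (y \<tau> d * prod_list (map (y \<tau>) ks)))) (at \<tau>)"
proof (induction ks)
  case Nil
  then show ?case by simp
next
  case (Cons k ks)
  have "((\<lambda>\<sigma>. v k \<sigma> / v 0 \<sigma>) has_real_derivative
      (c * v (k + d) \<tau> * v 0 \<tau> - v k \<tau> * (c * v (0 + d) \<tau>)) / (v 0 \<tau> * v 0 \<tau>)) (at \<tau>)"
    by (intro DERIV_divide deriv pos)
  also have "(c * v (k + d) \<tau> * v 0 \<tau> - v k \<tau> * (c * v (0 + d) \<tau>)) / (v 0 \<tau> * v 0 \<tau>)
      = c * (y \<tau> (k + d) - y \<tau> k * y \<tau> d)"
    using pos by (simp add: y_def field_simps)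
  finally have yk: "((\<lambda>\<sigma>. y \<sigma> k) has_real_derivative c * (y \<tau> (k + d) - y \<tau> k * y \<tau> d)) (at \<tau>)"
    by (simp add: y_def)
  have "(\<Sum>ls\<leftarrow>map ((#) k) (bumps d ks). prod_list (map (y \<tau>) ls))
      = y \<tau> k * (\<Sum>ls\<leftarrow>bumps d ks. prod_list (map (y \<tau>) ls))"
    by (simp add: comp_def sum_list_const_mult)
  then show ?case
    using DERIV_mult[OF yk Cons.IH]
    by (simp add: algebra_simps)
qed

lemma DERIV_powr_peval:
  fixes v :: "nat \<Rightarrow> real \<Rightarrow> real"
  assumes deriv: "\<And>k. (v k has_real_derivative c * v (k + d) \<tau>) (at \<tau>)" and pos: "v 0 \<tau> > 0"
  defines "y \<equiv> \<lambda>\<sigma> k. v k \<sigma> / v 0 \<sigma>"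
  shows "((\<lambda>\<sigma>. v 0 \<sigma> powr \<alpha> * peval (y \<sigma>) P) has_real_derivative
    c * (v 0 \<tau> powr \<alpha> * peval (y \<tau>) (total d \<alpha> P))) (at \<tau>)"
proof (induction P)
  case Nil
  then show ?case by simp
next
  case (Cons p P)
  obtain e ks where p: "p = (e, ks)" by (cases p)
  let ?m = "\<lambda>ks \<sigma>. prod_list (map (y \<sigma>) ks)"
  have m: "((\<lambda>\<sigma>. ?m ks \<sigma>) has_real_derivative
    c * ((\<Sum>ls\<leftarrow>bumps d ks. ?m ls \<tau>) - real (length ks) * (y \<tau> d * ?m ks \<tau>))) (at \<tau>)"
    unfolding y_def by (rule DERIV_prod_list_quotients) (use deriv pos in auto)
  have "((\<lambda>\<sigma>. v 0 \<sigma> powr \<alpha>) has_real_derivative \<alpha> * v 0 \<tau> powr (\<alpha> - 1) * (c * v (0 + d) \<tau>)) (at \<tau>)"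
    using DERIV_fun_powr[OF deriv[of 0] pos, of \<alpha>] by simp
  also have "\<alpha> * v 0 \<tau> powr (\<alpha> - 1) * (c * v (0 + d) \<tau>) = c * (v 0 \<tau> powr \<alpha> * (\<alpha> * y \<tau> d))"
    using pos by (simp add: y_def powr_diff)
  finally have w: "((\<lambda>\<sigma>. v 0 \<sigma> powr \<alpha>) has_real_derivative c * (v 0 \<tau> powr \<alpha> * (\<alpha> * y \<tau> d))) (at \<tau>)" .
  have "((\<lambda>\<sigma>. e * (v 0 \<sigma> powr \<alpha> * ?m ks \<sigma>) + v 0 \<sigma> powr \<alpha> * peval (y \<sigma>) P) has_real_derivative
     e * (c * (v 0 \<tau> powr \<alpha> * (\<alpha> * y \<tau> d)) * ?m ks \<tau>
        + c * ((\<Sum>ls\<leftarrow>bumps d ks. ?m ls \<tau>) - real (length ks) * (y \<tau> d * ?m ks \<tau>)) * v 0 \<tau> powr \<alpha>)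
     + c * (v 0 \<tau> powr \<alpha> * peval (y \<tau>) (total d \<alpha> P))) (at \<tau>)"
    by (intro DERIV_add DERIV_cmult DERIV_mult m w Cons.IH)
  then show ?case
    by (simp add: p peval_map_const algebra_simps)
qed

context heat_density
begin

text \<open>Tame functions are those that grow more slowly than every power of the quotient of the
solution at time \<open>b'\<close> and at time \<open>t\<close>, uniformly for \<open>t\<close> in \<open>[a, b]\<close>.  The factor
\<open>sqrt (b' / a)\<close> makes this quotient at least one.  In contrast to boundedness by a fixed power
the property is stable under products.\<close>

definition tame :: "real \<Rightarrow> real \<Rightarrow> real \<Rightarrow> (real \<Rightarrow> real \<Rightarrow> real) \<Rightarrow> bool" where
  "tame a b b' E \<longleftrightarrow> (\<forall>\<epsilon>>0. \<exists>C. \<forall>t x. a \<le> t \<longrightarrow> t \<le> b \<longrightarrow>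
     \<bar>E t x\<bar> \<le> C * (sqrt (b' / a) * heat 0 b' x / heat 0 t x) powr \<epsilon>)"

lemma tame_ratio_ge_1:
  assumes "0 < a" "b < b'" "a \<le> t" "t \<le> b"
  shows "1 \<le> sqrt (b' / a) * heat 0 b' x / heat 0 t x"
proof -
  have u: "heat 0 t x > 0" "heat 0 b' x > 0" using assms by (auto intro!: heat_0_pos)
  have "heat 0 t x \<le> sqrt (b' / t) * heat 0 b' x"
    using assms by (intro heat_0_mono) auto
  also have "\<dots> \<le> sqrt (b' / a) * heat 0 b' x"
    using assms u by (intro mult_right_mono real_sqrt_le_mono divide_left_mono) auto
  finally show ?thesis using u by simp
qed

lemma tame_const:
  assumes "0 < a" "b < b'"
  shows "tame a b b' (\<lambda>_ _. c)"
  unfolding tame_def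
proof (intro allI impI exI)
  fix \<epsilon> t x :: real
  assume "\<epsilon> > 0" and t: "a \<le> t" "t \<le> b"
  have "\<bar>c\<bar> * 1 \<le> \<bar>c\<bar> * (sqrt (b' / a) * heat 0 b' x / heat 0 t x) powr \<epsilon>"
    using tame_ratio_ge_1[OF assms t, of x] \<open>\<epsilon> > 0\<close> by (intro mult_left_mono ge_one_powr_ge_zero) auto
  then show "\<bar>c\<bar> \<le> \<bar>c\<bar> * (sqrt (b' / a) * heat 0 b' x / heat 0 t x) powr \<epsilon>" by simp
qed

lemma tame_add:
  assumes "tame a b b' E" "tame a b b' F"
  shows "tame a b b' (\<lambda>t x. E t x + F t x)"
  unfolding tame_def
proof (intro allI impI)
  fix \<epsilon> :: real assume \<epsilon>: "\<epsilon> > 0"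
  let ?r = "\<lambda>t x. (sqrt (b' / a) * heat 0 b' x / heat 0 t x) powr \<epsilon>"
  from assms(1) \<epsilon> obtain C where C: "\<And>t x. a \<le> t \<Longrightarrow> t \<le> b \<Longrightarrow> \<bar>E t x\<bar> \<le> C * ?r t x"
    unfolding tame_def by meson
  from assms(2) \<epsilon> obtain D where D: "\<And>t x. a \<le> t \<Longrightarrow> t \<le> b \<Longrightarrow> \<bar>F t x\<bar> \<le> D * ?r t x"
    unfolding tame_def by meson
  have "\<bar>E t x + F t x\<bar> \<le> (C + D) * ?r t x" if "a \<le> t" "t \<le> b" for t x
    unfolding distrib_right using C[OF that, of x] D[OF that, of x] by linarith
  then show "\<exists>C. \<forall>t x. a \<le> t \<longrightarrow> t \<le> b \<longrightarrow> \<bar>E t x + F t x\<bar> \<le> C * ?r t x" by blast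
qed

lemma tame_mult:
  assumes "tame a b b' E" "tame a b b' F"
  shows "tame a b b' (\<lambda>t x. E t x * F t x)"
  unfolding tame_def
proof (intro allI impI)
  fix \<epsilon> :: real assume "\<epsilon> > 0"
  then have \<epsilon>: "\<epsilon> / 2 > 0" by simp
  let ?r = "\<lambda>\<epsilon> t x. (sqrt (b' / a) * heat 0 b' x / heat 0 t x) powr \<epsilon>"
  from assms(1) \<epsilon> obtain C where C: "\<And>t x. a \<le> t \<Longrightarrow> t \<le> b \<Longrightarrow> \<bar>E t x\<bar> \<le> C * ?r (\<epsilon> / 2) t x"
    unfolding tame_def by meson
  from assms(2) \<epsilon> obtain D where D: "\<And>t x. a \<le> t \<Longrightarrow> t \<le> b \<Longrightarrow> \<bar>F t x\<bar> \<le> D * ?r (\<epsilon> / 2) t x"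
    unfolding tame_def by meson
  have "\<bar>E t x * F t x\<bar> \<le> (C * D) * ?r \<epsilon> t x" if t: "a \<le> t" "t \<le> b" for t x
  proof -
    have "\<bar>E t x * F t x\<bar> \<le> (C * ?r (\<epsilon> / 2) t x) * (D * ?r (\<epsilon> / 2) t x)"
      unfolding abs_mult by (intro mult_mono C D t order_trans[OF abs_ge_zero C[OF t]]) auto
    also have "\<dots> = (C * D) * ?r (\<epsilon> / 2 + \<epsilon> / 2) t x"
      by (simp only: powr_add mult_ac)
    finally show ?thesis by simp
  qed
  then show "\<exists>C. \<forall>t x. a \<le> t \<longrightarrow> t \<le> b \<longrightarrow> \<bar>E t x * F t x\<bar> \<le> C * ?r \<epsilon> t x" by blast
qed

lemma tame_heat_quotient:
  assumes "0 < a" "a \<le> b" "b < b'"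
  shows "tame a b b' (\<lambda>t x. heat k t x / heat 0 t x)"
  unfolding tame_def
proof (intro allI impI)
  fix \<epsilon> :: real assume \<epsilon>: "\<epsilon> > 0"
  let ?R = "\<lambda>t x. sqrt (b' / a) * heat 0 b' x / heat 0 t x"
  obtain m where m: "1 / real (Suc m) < \<epsilon>"
    using reals_Archimedean[OF \<epsilon>] by (auto simp: inverse_eq_divide)
  from heat_bound[OF assms, of k m] obtain C where C: "\<And>t x. a \<le> t \<Longrightarrow> t \<le> b \<Longrightarrow>
      \<bar>heat k t x\<bar> \<le> C * heat 0 t x * (heat 0 b' x / heat 0 t x) powr (1 / real (Suc m))" by blast
  have "\<bar>heat k t x / heat 0 t x\<bar> \<le> \<bar>C\<bar> * ?R t x powr \<epsilon>" if t: "a \<le> t" "t \<le> b" for t x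
  proof -
    have u: "heat 0 t x > 0" "heat 0 b' x > 0" using assms t by (auto intro!: heat_0_pos)
    have "1 \<le> sqrt (b' / a)" using assms by simp
    then have "1 * heat 0 b' x \<le> sqrt (b' / a) * heat 0 b' x"
      using u by (intro mult_right_mono) auto
    then have R: "heat 0 b' x / heat 0 t x \<le> ?R t x"
      using u by (intro divide_right_mono) auto
    have "\<bar>heat k t x / heat 0 t x\<bar> \<le> C * (heat 0 b' x / heat 0 t x) powr (1 / real (Suc m))"
      using C[OF t, of x] u by (simp add: abs_divide pos_divide_le_eq mult_ac)
    also have "\<dots> \<le> \<bar>C\<bar> * (heat 0 b' x / heat 0 t x) powr (1 / real (Suc m))"
      by (intro mult_right_mono) auto
    also have "\<dots> \<le> \<bar>C\<bar> * ?R t x powr (1 / real (Suc m))"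
      using R u by (intro mult_left_mono powr_mono2) auto
    also have "\<dots> \<le> \<bar>C\<bar> * ?R t x powr \<epsilon>"
      using m tame_ratio_ge_1[OF assms(1,3) t, of x] by (intro mult_left_mono powr_mono) auto
    finally show ?thesis .
  qed
  then show "\<exists>C. \<forall>t x. a \<le> t \<longrightarrow> t \<le> b \<longrightarrow> \<bar>heat k t x / heat 0 t x\<bar> \<le> C * ?R t x powr \<epsilon>" by blast
qed

definition ratio :: "real \<Rightarrow> real \<Rightarrow> nat \<Rightarrow> real" where
  "ratio t x k = heat k t x / heat 0 t x"

lemma tame_peval:
  assumes "0 < a" "a \<le> b" "b < b'"
  shows "tame a b b' (\<lambda>t x. peval (ratio t x) P)"
proof (induction P)
  case Nil
  then show ?case using tame_const assms by simp
next
  case (Cons p P)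
  obtain c ks where p: "p = (c, ks)" by (cases p)
  have "tame a b b' (\<lambda>t x. prod_list (map (ratio t x) ks))"
  proof (induction ks)
    case (Cons k ks)
    have "tame a b b' (\<lambda>t x. ratio t x k)"
      using tame_heat_quotient[OF assms] by (simp add: ratio_def)
    then show ?case using Cons by (auto intro: tame_mult)
  qed (use assms tame_const in simp)
  then show ?case
    using assms by (auto simp: p intro!: tame_add tame_mult tame_const Cons.IH)
qed

text \<open>Choosing the exponent \<open>\<alpha>\<close> in the definition of tameness cancels the power of the solution at
time \<open>t\<close> and leaves a dominating function that does not depend on \<open>t\<close>.\<close>

lemma powr_peval_dominated:
  assumes "0 < a" "a \<le> b" "b < b'" "\<alpha> > 0"
  shows "\<exists>C. \<forall>t x. a \<le> t \<longrightarrow> t \<le> b \<longrightarrow> \<bar>heat 0 t x powr \<alpha> * peval (ratio t x) P\<bar> \<le> C * heat 0 b' x powr \<alpha>"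
proof -
  from tame_peval[OF assms(1-3), of P] assms(4) obtain C where C: "\<And>t x. a \<le> t \<Longrightarrow> t \<le> b \<Longrightarrow>
      \<bar>peval (ratio t x) P\<bar> \<le> C * (sqrt (b' / a) * heat 0 b' x / heat 0 t x) powr \<alpha>"
    unfolding tame_def by meson
  have "\<bar>heat 0 t x powr \<alpha> * peval (ratio t x) P\<bar> \<le> (C * sqrt (b' / a) powr \<alpha>) * heat 0 b' x powr \<alpha>"
    if t: "a \<le> t" "t \<le> b" for t x
  proof -
    have u: "heat 0 t x > 0" "heat 0 b' x > 0" using assms t by (auto intro!: heat_0_pos)
    have "\<bar>heat 0 t x powr \<alpha> * peval (ratio t x) P\<bar> \<le> heat 0 t x powr \<alpha> * (C * (sqrt (b' / a) * heat 0 b' x / heat 0 t x) powr \<alpha>)"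
      unfolding abs_mult using C[OF t] by (intro mult_mono) auto
    also have "\<dots> = (C * sqrt (b' / a) powr \<alpha>) * heat 0 b' x powr \<alpha>"
      using u assms by (simp add: powr_divide powr_mult)
    finally show ?thesis .
  qed
  then show ?thesis by blast
qed

lemma continuous_on_powr_peval:
  assumes "t > 0"
  shows "continuous_on UNIV (\<lambda>x. heat 0 t x powr \<alpha> * peval (ratio t x) P)"
proof -
  have "continuous_on UNIV (\<lambda>x. ratio t x k)" for k
    unfolding ratio_def using continuous_on_heat[OF assms] heat_0_pos[OF assms]
    by (intro continuous_on_divide) (auto simp: less_imp_neq[symmetric])
  then have "continuous_on UNIV (\<lambda>x. prod_list (map (ratio t x) ks))" for ks
    by (induction ks) (auto intro!: continuous_intros)
  then have "continuous_on UNIV (\<lambda>x. peval (ratio t x) P)"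
    by (induction P) (auto intro!: continuous_intros)
  then show ?thesis
    using continuous_on_heat[OF assms, of 0] heat_0_pos[OF assms]
    by (intro continuous_on_mult continuous_on_powr) (auto simp: less_imp_neq[symmetric])
qed

definition moment :: "real \<Rightarrow> dpoly \<Rightarrow> real \<Rightarrow> real" where
  "moment \<alpha> P t = (LINT x|lborel. heat 0 t x powr \<alpha> * peval (ratio t x) P)"

lemma integrable_powr_peval:
  assumes "t > 0" "\<alpha> > 0" and int: "\<And>t. t > 0 \<Longrightarrow> integrable lborel (\<lambda>x. heat 0 t x powr \<alpha>)"
  shows "integrable lborel (\<lambda>x. heat 0 t x powr \<alpha> * peval (ratio t x) P)"
proof -
  obtain C where C: "\<And>x. \<bar>heat 0 t x powr \<alpha> * peval (ratio t x) P\<bar> \<le> C * heat 0 (t + 1) x powr \<alpha>"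
    using powr_peval_dominated[of t t "t + 1" \<alpha> P] assms by auto
  show ?thesis
  proof (rule Bochner_Integration.integrable_bound)
    show "integrable lborel (\<lambda>x. C * heat 0 (t + 1) x powr \<alpha>)"
      using assms by (intro integrable_mult_right int) auto
    show "(\<lambda>x. heat 0 t x powr \<alpha> * peval (ratio t x) P) \<in> borel_measurable lborel"
      using borel_measurable_continuous_onI[OF continuous_on_powr_peval[OF assms(1)]] by simp
    show "AE x in lborel. norm (heat 0 t x powr \<alpha> * peval (ratio t x) P) \<le> norm (C * heat 0 (t + 1) x powr \<alpha>)"
      using C by (intro AE_I2) (auto intro: order_trans[OF _ abs_ge_self])
  qed
qed

lemma DERIV_moment:
  assumes "t > 0" "\<alpha> > 0" and int: "\<And>t. t > 0 \<Longrightarrow> integrable lborel (\<lambda>x. heat 0 t x powr \<alpha>)"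
  shows "(moment \<alpha> P has_real_derivative moment \<alpha> (total 2 \<alpha> P) t / 2) (at t)"
proof -
  obtain C where C: "\<And>s x. t / 2 \<le> s \<Longrightarrow> s \<le> 2 * t \<Longrightarrow>
      \<bar>heat 0 s x powr \<alpha> * peval (ratio s x) (total 2 \<alpha> P)\<bar> \<le> C * heat 0 (3 * t) x powr \<alpha>"
    using powr_peval_dominated[of "t / 2" "2 * t" "3 * t" \<alpha> "total 2 \<alpha> P"] assms by auto
  have "((\<lambda>s. LINT x|lborel. heat 0 s x powr \<alpha> * peval (ratio s x) P) has_real_derivative
     (LINT x|lborel. 1 / 2 * (heat 0 t x powr \<alpha> * peval (ratio t x) (total 2 \<alpha> P)))) (at t)"
  proof (rule has_real_derivative_integral[where a = "t / 2" and b = "2 * t" and h = "\<lambda>x. C * heat 0 (3 * t) x powr \<alpha>"])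
    show "((\<lambda>s. heat 0 s x powr \<alpha> * peval (ratio s x) P) has_real_derivative
        1 / 2 * (heat 0 s x powr \<alpha> * peval (ratio s x) (total 2 \<alpha> P))) (at s)" if "t / 2 < s" for s x
    proof -
      have "s > 0" using that assms by simp
      have ratio': "ratio s x = (\<lambda>k. heat k s x / heat 0 s x)" for s by (simp add: ratio_def fun_eq_iff)
      show ?thesis unfolding ratio'
        by (rule DERIV_powr_peval[where v = "\<lambda>k s. heat k s x"])
           (use DERIV_heat_t[OF \<open>s > 0\<close>] heat_0_pos[OF \<open>s > 0\<close>] in auto)
    qed
    show "\<bar>1 / 2 * (heat 0 s x powr \<alpha> * peval (ratio s x) (total 2 \<alpha> P))\<bar> \<le> C * heat 0 (3 * t) x powr \<alpha>"
      if "t / 2 < s" "s < 2 * t" for s x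
      using C[of s x] that by linarith
    show "(\<lambda>x. 1 / 2 * (heat 0 t x powr \<alpha> * peval (ratio t x) (total 2 \<alpha> P))) \<in> borel_measurable lborel"
      using borel_measurable_continuous_onI[OF continuous_on_powr_peval[OF assms(1)]] by simp
  qed (use assms integrable_powr_peval in auto)
  then show ?thesis by (simp add: moment_def[abs_def])
qed

lemma moment_total_1:
  assumes "t > 0" "\<alpha> > 0" and int: "\<And>t. t > 0 \<Longrightarrow> integrable lborel (\<lambda>x. heat 0 t x powr \<alpha>)"
  shows "moment \<alpha> (total 1 \<alpha> P) t = 0"
  unfolding moment_def
proof (rule integral_deriv_eq_0)
  show "((\<lambda>x. heat 0 t x powr \<alpha> * peval (ratio t x) P) has_real_derivative
        heat 0 t x powr \<alpha> * peval (ratio t x) (total 1 \<alpha> P)) (at x)" for x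
  proof -
    have ratio': "ratio t x = (\<lambda>k. heat k t x / heat 0 t x)" for x by (simp add: ratio_def fun_eq_iff)
    have "((\<lambda>x. heat 0 t x powr \<alpha> * peval (ratio t x) P) has_real_derivative
        1 * (heat 0 t x powr \<alpha> * peval (ratio t x) (total 1 \<alpha> P))) (at x)"
      unfolding ratio'
      by (rule DERIV_powr_peval[where v = "\<lambda>k x. heat k t x"])
         (use DERIV_heat_x[OF assms(1)] heat_0_pos[OF assms(1)] in auto)
    then show ?thesis by simp
  qed
qed (use assms integrable_powr_peval continuous_on_powr_peval in auto)

lemma moment_append:
  assumes "t > 0" "\<alpha> > 0" and int: "\<And>t. t > 0 \<Longrightarrow> integrable lborel (\<lambda>x. heat 0 t x powr \<alpha>)"
  shows "moment \<alpha> (P @ Q) t = moment \<alpha> P t + moment \<alpha> Q t"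
  using assms integrable_powr_peval by (simp add: moment_def distrib_left)

end

section \<open>Uniqueness of bounded solutions\<close>

text \<open>The subtracted term \<open>\<epsilon> (x\<^sup>2 + 2 t)\<close> confines the maximum to a compact set and makes the
differential inequality strict: its time derivative is \<open>2 \<epsilon>\<close>, while half its second spatial
derivative is only \<open>\<epsilon>\<close>.\<close>

lemma heat_max_principle:
  fixes v vt vx vxx :: "real \<Rightarrow> real \<Rightarrow> real"
  assumes cont: "continuous_on (UNIV \<times> {0..}) (\<lambda>(x, t). v x t)"
    and bdd: "\<And>x t. t \<ge> 0 \<Longrightarrow> v x t \<le> B"
    and init: "\<And>x. v x 0 \<le> 0"
    and dt: "\<And>x t. t > 0 \<Longrightarrow> ((\<lambda>s. v x s) has_real_derivative vt x t) (at t)"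
    and dx: "\<And>x t. t > 0 \<Longrightarrow> ((\<lambda>y. v y t) has_real_derivative vx x t) (at x)"
    and dxx: "\<And>x t. t > 0 \<Longrightarrow> ((\<lambda>y. vx y t) has_real_derivative vxx x t) (at x)"
    and heat: "\<And>x t. t > 0 \<Longrightarrow> vt x t = vxx x t / 2"
    and T: "T > 0"
  shows "v x0 T \<le> 0"
proof (rule ccontr)
  assume "\<not> v x0 T \<le> 0"
  then have pos: "v x0 T > 0" by simp
  define D where "D = x0\<^sup>2 + 2 * T"
  define \<epsilon> where "\<epsilon> = v x0 T / (2 * D)"
  have den: "D > 0" unfolding D_def using T by (intro add_nonneg_pos) auto
  have \<epsilon>: "\<epsilon> > 0" using pos den by (simp add: \<epsilon>_def)
  define \<phi> where "\<phi> x t = v x t - \<epsilon> * (x\<^sup>2 + 2 * t)" for x t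
  have \<phi>0: "\<phi> x0 T > 0"
    using pos den by (simp add: \<phi>_def \<epsilon>_def flip: D_def)
  \<comment> \<open>For \<open>\<bar>x\<bar> = R\<close> the subtracted term exceeds the upper bound \<open>B\<close> of \<open>v\<close>.\<close>
  define R where "R = max (\<bar>x0\<bar>) (sqrt ((\<bar>B\<bar> + 1) / \<epsilon>))"
  have R: "\<bar>x0\<bar> \<le> R" "R \<ge> 0" by (auto simp: R_def)
  have "(\<bar>B\<bar> + 1) / \<epsilon> = (sqrt ((\<bar>B\<bar> + 1) / \<epsilon>))\<^sup>2" using \<epsilon> by simp
  also have "\<dots> \<le> R\<^sup>2" using \<epsilon> by (intro power_mono) (auto simp: R_def)
  finally have R2: "\<epsilon> * R\<^sup>2 \<ge> \<bar>B\<bar> + 1" using \<epsilon> by (simp add: field_simps)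
  let ?K = "{-R..R} \<times> {0..T}"
  have "\<exists>p\<in>?K. \<forall>q\<in>?K. (case q of (x, t) \<Rightarrow> \<phi> x t) \<le> (case p of (x, t) \<Rightarrow> \<phi> x t)"
  proof (rule continuous_attains_sup)
    show "compact ?K" by (intro compact_Times compact_Icc)
    show "?K \<noteq> {}" using R T by auto
    have "continuous_on ?K (\<lambda>p. (case p of (x, t) \<Rightarrow> v x t) - \<epsilon> * ((fst p)\<^sup>2 + 2 * snd p))"
      by (intro continuous_intros continuous_on_subset[OF cont]) auto
    then show "continuous_on ?K (\<lambda>p. case p of (x, t) \<Rightarrow> \<phi> x t)"
      by (simp add: \<phi>_def case_prod_unfold)
  qed
  then obtain x1 t1 where K: "x1 \<in> {-R..R}" "t1 \<in> {0..T}"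
    and max: "\<And>x t. x \<in> {-R..R} \<Longrightarrow> t \<in> {0..T} \<Longrightarrow> \<phi> x t \<le> \<phi> x1 t1"
    by auto
  have \<phi>1: "\<phi> x1 t1 > 0" using R T by (intro less_le_trans[OF \<phi>0 max]) auto
  have "t1 \<noteq> 0"
  proof
    assume "t1 = 0"
    then have "\<phi> x1 t1 \<le> 0"
      using order_trans[OF init[of x1], of "\<epsilon> * x1\<^sup>2"] \<epsilon> by (simp add: \<phi>_def)
    then show False using \<phi>1 by simp
  qed
  then have t1: "t1 > 0" "t1 \<le> T" using K by auto
  have "\<bar>x1\<bar> \<noteq> R"
  proof
    assume "\<bar>x1\<bar> = R"
    then have "x1\<^sup>2 = R\<^sup>2" by (metis power2_abs)
    then have "\<phi> x1 t1 \<le> B - \<epsilon> * R\<^sup>2 - \<epsilon> * (2 * t1)"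
      using bdd[of t1 x1] t1 by (simp add: \<phi>_def algebra_simps)
    also have "\<dots> < 0" using R2 mult_pos_pos[OF \<epsilon>, of "2 * t1"] t1 by linarith
    finally show False using \<phi>1 by simp
  qed
  then have x1: "\<bar>x1\<bar> < R" using K by auto
  have Dt: "(\<phi> x1 has_real_derivative vt x1 t1 - 2 * \<epsilon>) (at t1)"
    unfolding \<phi>_def using t1 by (auto intro!: derivative_eq_intros dt)
  have vt: "vt x1 t1 - 2 * \<epsilon> \<ge> 0"
  proof (rule ccontr)
    assume "\<not> ?thesis"
    then obtain d where d: "d > 0" "\<And>h. 0 < h \<Longrightarrow> h < d \<Longrightarrow> \<phi> x1 t1 < \<phi> x1 (t1 - h)"
      using DERIV_neg_dec_left[OF Dt] by auto
    define h where "h = min (d / 2) t1"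
    have "0 < h" "h < d" "h \<le> t1" using d t1 by (auto simp: h_def)
    then show False using d(2)[of h] max[of x1 "t1 - h"] K t1 by auto
  qed
  have Dx: "((\<lambda>y. \<phi> y t1) has_real_derivative vx y t1 - 2 * \<epsilon> * y) (at y)" for y
    unfolding \<phi>_def using t1 by (auto intro!: derivative_eq_intros dx)
  have Dxx: "((\<lambda>y. vx y t1 - 2 * \<epsilon> * y) has_real_derivative vxx x1 t1 - 2 * \<epsilon>) (at x1)"
    using t1 by (auto intro!: derivative_eq_intros dxx)
  have loc: "\<phi> y t1 \<le> \<phi> x1 t1" if "\<bar>x1 - y\<bar> < R - \<bar>x1\<bar>" for y
    using that K t1 by (intro max) auto
  have crit: "vx x1 t1 - 2 * \<epsilon> * x1 = 0"
    using x1 loc by (intro DERIV_local_max[OF Dx, of "R - \<bar>x1\<bar>"]) auto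
  have vxx: "vxx x1 t1 - 2 * \<epsilon> \<le> 0"
  proof (rule ccontr)
    assume "\<not> ?thesis"
    then obtain d where d: "d > 0" "\<And>h. 0 < h \<Longrightarrow> h < d \<Longrightarrow> 0 < vx (x1 + h) t1 - 2 * \<epsilon> * (x1 + h)"
      using DERIV_pos_inc_right[OF Dxx] crit by auto
    define h where "h = min (d / 2) ((R - \<bar>x1\<bar>) / 2)"
    have h: "0 < h" "h < d" "h < R - \<bar>x1\<bar>" using d x1 by (auto simp: h_def min_def)
    have "\<phi> x1 t1 < \<phi> (x1 + h) t1"
    proof (rule DERIV_pos_imp_increasing_open[where f = "\<lambda>y. \<phi> y t1"])
      show "\<exists>z. ((\<lambda>y. \<phi> y t1) has_real_derivative z) (at y) \<and> 0 < z" if "x1 < y" "y < x1 + h" for y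
        using Dx[of y] d(2)[of "y - x1"] that h by auto
      show "continuous_on {x1..x1 + h} (\<lambda>y. \<phi> y t1)"
        by (rule DERIV_continuous_on[OF has_field_derivative_at_within[OF Dx]])
    qed (use h in auto)
    then show False using loc[of "x1 + h"] h by auto
  qed
  show False using vt vxx heat[OF t1(1), of x1] \<epsilon> by linarith
qed

context heat_density
begin

text \<open>The substitution \<open>y = x + \<surd>t z\<close> in the convolution integral gives a formula that makes sense
at \<open>t = 0\<close> too, where it returns the initial value.\<close>

definition heat_ext :: "real \<Rightarrow> real \<Rightarrow> real" where
  "heat_ext x t = (LINT z|lborel. g (x + sqrt t * z) * heat_kernel 0 1 z)"

lemma heat_eq_heat_ext:
  assumes t: "t > 0"
  shows "heat 0 t x = heat_ext x t"
proof -
  have scale: "sqrt t * heat_kernel 0 t (sqrt t * z) = heat_kernel 0 1 z" for z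
    using t by (simp add: heat_kernel_0 power_mult_distrib real_sqrt_mult)
  have "heat 0 t x = \<bar>sqrt t\<bar> *\<^sub>R (LINT z|lborel. g (x + sqrt t * z) * heat_kernel 0 t (x - (x + sqrt t * z)))"
    unfolding heat_def using t by (intro lborel_integral_real_affine) auto
  also have "\<dots> = (LINT z|lborel. g (x + sqrt t * z) * (sqrt t * heat_kernel 0 t (sqrt t * z)))"
    using t by (simp add: heat_kernel_0 power_mult_distrib mult_ac flip: integral_mult_right_zero)
  also have "\<dots> = heat_ext x t"
    unfolding heat_ext_def by (simp only: scale)
  finally show ?thesis .
qed

lemma heat_kernel_0_1_integral: "integrable lborel (heat_kernel 0 1)" "(LINT z|lborel. heat_kernel 0 1 z) = 1"
  using heat_kernel_0_integral(1,2)[of 1 0] by simp_all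

lemma heat_ext_0: "heat_ext x 0 = g x"
  by (simp add: heat_ext_def heat_kernel_0_1_integral)

lemma continuous_on_heat_ext: "continuous_on (UNIV \<times> {0..}) (\<lambda>(x, t). heat_ext x t)"
proof -
  obtain B where B: "B > 0" "\<And>x. \<bar>g x\<bar> \<le> B"
    using g_bdd by (auto simp: bounded_pos)
  have "(\<lambda>n. heat_ext (fst (p n)) (snd (p n))) \<longlonglongrightarrow> heat_ext (fst q) (snd q)"
    if p: "p \<longlonglongrightarrow> q" for p :: "nat \<Rightarrow> real \<times> real" and q
    unfolding heat_ext_def
  proof (rule integral_dominated_convergence[where w = "\<lambda>z. B * heat_kernel 0 1 z"])
    show "(\<lambda>z. g (fst q + sqrt (snd q) * z) * heat_kernel 0 1 z) \<in> borel_measurable lborel"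
      "\<And>n. (\<lambda>z. g (fst (p n) + sqrt (snd (p n)) * z) * heat_kernel 0 1 z) \<in> borel_measurable lborel"
      by simp_all
    show "integrable lborel (\<lambda>z. B * heat_kernel 0 1 z)"
      by (intro integrable_mult_right heat_kernel_0_1_integral)
    show "AE z in lborel. (\<lambda>n. g (fst (p n) + sqrt (snd (p n)) * z) * heat_kernel 0 1 z)
        \<longlonglongrightarrow> g (fst q + sqrt (snd q) * z) * heat_kernel 0 1 z"
    proof (intro AE_I2 tendsto_mult_right)
      fix z
      have "isCont g (fst q + sqrt (snd q) * z)"
        using g_cont by (simp add: continuous_on_eq_continuous_at)
      moreover have "(\<lambda>n. fst (p n) + sqrt (snd (p n)) * z) \<longlonglongrightarrow> fst q + sqrt (snd q) * z"
        by (intro tendsto_intros p)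
      ultimately show "(\<lambda>n. g (fst (p n) + sqrt (snd (p n)) * z)) \<longlonglongrightarrow> g (fst q + sqrt (snd q) * z)"
        by (rule isCont_tendsto_compose)
    qed
    show "AE z in lborel. norm (g (fst (p n) + sqrt (snd (p n)) * z) * heat_kernel 0 1 z) \<le> B * heat_kernel 0 1 z" for n
      using B heat_kernel_0_pos[of 1] by (intro AE_I2) (auto simp: abs_mult intro!: mult_mono mult_nonneg_nonneg less_imp_le[OF heat_kernel_0_pos])
  qed
  then show ?thesis
    by (auto simp: continuous_on_sequentially comp_def case_prod_unfold)
qed

lemma heat_ext_bounded: "\<exists>B. \<forall>x t. \<bar>heat_ext x t\<bar> \<le> B"
proof -
  obtain B where B: "B > 0" "\<And>x. \<bar>g x\<bar> \<le> B"
    using g_bdd by (auto simp: bounded_pos)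
  have "\<bar>heat_ext x t\<bar> \<le> B" for x t
  proof -
    have "\<bar>heat_ext x t\<bar> \<le> (LINT z|lborel. \<bar>g (x + sqrt t * z) * heat_kernel 0 1 z\<bar>)"
      unfolding heat_ext_def by (rule integral_abs_bound)
    also have "\<dots> \<le> (LINT z|lborel. B * heat_kernel 0 1 z)"
      using B heat_kernel_0_pos[of 1] heat_kernel_0_1_integral
      by (intro integral_mono' integrable_mult_right) (auto simp: abs_mult intro!: mult_mono mult_nonneg_nonneg less_imp_le[OF heat_kernel_0_pos])
    finally show ?thesis using heat_kernel_0_1_integral by simp
  qed
  then show ?thesis by blast
qed

theorem bounded_heat_cauchy_solution_unique:
  assumes sol: "bounded_heat_cauchy_solution g u" and t: "t > 0"
  shows "u x t = heat 0 t x"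
proof -
  have hc: "heat_cauchy_solution g u" and "bounded ((\<lambda>(x, t). u x t) ` (UNIV \<times> {0..}))"
    using sol by (auto simp: bounded_heat_cauchy_solution_def)
  then obtain B1 where B1: "\<And>x t. t \<ge> 0 \<Longrightarrow> \<bar>u x t\<bar> \<le> B1"
    by (auto simp: bounded_iff)
  obtain B2 where B2: "\<And>x t. \<bar>heat_ext x t\<bar> \<le> B2" using heat_ext_bounded by blast
  define ux where "ux x t = deriv (\<lambda>y. u y t) x" for x t
  define uxx where "uxx x t = deriv (\<lambda>y. ux y t) x" for x t
  have cont: "continuous_on (UNIV \<times> {0..}) (\<lambda>(x, t). u x t)" and init: "\<And>x. u x 0 = g x"
    using hc by (auto simp: heat_cauchy_solution_def)
  have dt: "((\<lambda>s. u x s) has_real_derivative uxx x t / 2) (at t)"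
    and dx: "((\<lambda>y. u y t) has_real_derivative ux x t) (at x)"
    and dxx: "((\<lambda>y. ux y t) has_real_derivative uxx x t) (at x)" if "t > 0" for x t
  proof -
    have *: "(\<lambda>s. u x s) differentiable (at t)" "(\<lambda>y. u y t) differentiable (at x)"
      "deriv (\<lambda>y. u y t) differentiable (at x)"
      "deriv (\<lambda>s. u x s) t = 1 / 2 * (deriv ^^ 2) (\<lambda>y. u y t) x"
      using hc that by (auto simp: heat_cauchy_solution_def)
    have ux: "deriv (\<lambda>y. u y t) = (\<lambda>y. ux y t)" by (simp add: ux_def fun_eq_iff)
    have "deriv (\<lambda>s. u x s) t = uxx x t / 2"
      using *(4) by (simp add: numeral_2_eq_2 ux uxx_def)
    then show "((\<lambda>s. u x s) has_real_derivative uxx x t / 2) (at t)"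
      using *(1) by (metis DERIV_deriv_iff_real_differentiable)
    show "((\<lambda>y. u y t) has_real_derivative ux x t) (at x)"
      using *(2) unfolding ux_def by (metis DERIV_deriv_iff_real_differentiable)
    show "((\<lambda>y. ux y t) has_real_derivative uxx x t) (at x)"
      using *(3) unfolding uxx_def ux by (metis DERIV_deriv_iff_real_differentiable)
  qed
  have Wt: "((\<lambda>s. heat_ext x s) has_real_derivative heat 2 t x / 2) (at t)"
    and Wx: "((\<lambda>y. heat_ext y t) has_real_derivative heat (Suc 0) t x) (at x)"
    and Wxx: "((\<lambda>y. heat (Suc 0) t y) has_real_derivative heat 2 t x) (at x)" if "t > 0" for x t
  proof -
    have "((\<lambda>s. heat 0 s x) has_real_derivative heat 2 t x / 2) (at t)"
      using DERIV_heat_t[OF that, of 0 x] by (simp add: numeral_2_eq_2)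
    moreover have "\<forall>\<^sub>F s in nhds t. heat 0 s x = heat_ext x s"
      using eventually_nhds_in_open[of "{0<..}" t] that by (auto elim!: eventually_mono simp: heat_eq_heat_ext)
    ultimately show "((\<lambda>s. heat_ext x s) has_real_derivative heat 2 t x / 2) (at t)"
      using DERIV_cong_ev[of t t "\<lambda>s. heat 0 s x" "\<lambda>s. heat_ext x s" "heat 2 t x / 2" "heat 2 t x / 2"] by simp
    have "(\<lambda>y. heat_ext y t) = heat 0 t" using heat_eq_heat_ext[OF that] by (simp add: fun_eq_iff)
    then show "((\<lambda>y. heat_ext y t) has_real_derivative heat (Suc 0) t x) (at x)"
      using DERIV_heat_x[OF that, of 0 x] by simp
    show "((\<lambda>y. heat (Suc 0) t y) has_real_derivative heat 2 t x) (at x)"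
      using DERIV_heat_x[OF that, of "Suc 0" x] by (simp add: numeral_2_eq_2)
  qed
  have "u x t - heat_ext x t \<le> 0"
  proof (rule heat_max_principle[where v = "\<lambda>x t. u x t - heat_ext x t" and B = "B1 + B2"
        and vt = "\<lambda>x t. uxx x t / 2 - heat 2 t x / 2" and vx = "\<lambda>x t. ux x t - heat (Suc 0) t x"
        and vxx = "\<lambda>x t. uxx x t - heat 2 t x"])
    show "continuous_on (UNIV \<times> {0..}) (\<lambda>(x, t). u x t - heat_ext x t)"
      using continuous_on_diff[OF cont continuous_on_heat_ext] by (simp add: case_prod_unfold)
    show "u x t - heat_ext x t \<le> B1 + B2" if "t \<ge> 0" for x t
      using B1[OF that, of x] B2[of x t] by linarith
  qed (auto intro!: DERIV_diff dt dx dxx Wt Wx Wxx simp: init heat_ext_0 t diff_divide_distrib)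
  moreover have "heat_ext x t - u x t \<le> 0"
  proof (rule heat_max_principle[where v = "\<lambda>x t. heat_ext x t - u x t" and B = "B1 + B2"
        and vt = "\<lambda>x t. heat 2 t x / 2 - uxx x t / 2" and vx = "\<lambda>x t. heat (Suc 0) t x - ux x t"
        and vxx = "\<lambda>x t. heat 2 t x - uxx x t"])
    show "continuous_on (UNIV \<times> {0..}) (\<lambda>(x, t). heat_ext x t - u x t)"
      using continuous_on_diff[OF continuous_on_heat_ext cont] by (simp add: case_prod_unfold)
    show "heat_ext x t - u x t \<le> B1 + B2" if "t \<ge> 0" for x t
      using B1[OF that, of x] B2[of x t] by linarith
  qed (auto intro!: DERIV_diff dt dx dxx Wt Wx Wxx simp: init heat_ext_0 t diff_divide_distrib)
  ultimately show ?thesis using heat_eq_heat_ext[OF t, of x] by simp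
qed

end

section \<open>Integrability of powers of the solution\<close>

lemma powr_add_le:
  fixes x y \<alpha> :: real
  assumes "x \<ge> 0" "y \<ge> 0" "0 < \<alpha>" "\<alpha> \<le> 1"
  shows "(x + y) powr \<alpha> \<le> x powr \<alpha> + y powr \<alpha>"
proof (cases "x + y = 0")
  case False
  then have s: "x + y > 0" using assms by simp
  have frac: "z / (x + y) * (x + y) powr \<alpha> \<le> z powr \<alpha>" if "0 \<le> z" "z \<le> x + y" for z
  proof -
    have "(z / (x + y)) powr 1 \<le> (z / (x + y)) powr \<alpha>"
      using that s assms by (intro powr_mono') auto
    then have "z / (x + y) \<le> z powr \<alpha> / (x + y) powr \<alpha>"
      using that s by (simp add: powr_divide)
    then show ?thesis using s by (simp add: field_simps)
  qed
  have "x / (x + y) + y / (x + y) = 1"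
    using s by (simp add: add_divide_distrib[symmetric])
  then have "(x + y) powr \<alpha> = x / (x + y) * (x + y) powr \<alpha> + y / (x + y) * (x + y) powr \<alpha>"
    by (simp only: distrib_right[symmetric])
  also have "\<dots> \<le> x powr \<alpha> + y powr \<alpha>"
    using frac[of x] frac[of y] assms by auto
  finally show ?thesis .
qed (use assms in auto)

lemma powr_sum_le:
  fixes f :: "'a \<Rightarrow> real"
  assumes "finite A" "\<And>i. i \<in> A \<Longrightarrow> f i \<ge> 0" "0 < \<alpha>" "\<alpha> \<le> 1"
  shows "(\<Sum>i\<in>A. f i) powr \<alpha> \<le> (\<Sum>i\<in>A. f i powr \<alpha>)"
  using assms(1,2)
proof (induction A)
  case (insert a A)
  have "(f a + (\<Sum>i\<in>A. f i)) powr \<alpha> \<le> f a powr \<alpha> + (\<Sum>i\<in>A. f i) powr \<alpha>"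
    using insert.prems assms(3,4) by (intro powr_add_le sum_nonneg) auto
  also have "\<dots> \<le> f a powr \<alpha> + (\<Sum>i\<in>A. f i powr \<alpha>)"
    using insert by auto
  finally show ?case using insert by simp
qed simp

context heat_density
begin

lemma integrable_heat_powr_ge_1:
  assumes "t > 0" "\<alpha> \<ge> 1"
  shows "integrable lborel (\<lambda>x. heat 0 t x powr \<alpha>)"
proof -
  obtain B where B: "B > 0" "\<And>x. heat 0 t x \<le> B" using heat_0_bounded assms(1) by blast
  show ?thesis
  proof (rule Bochner_Integration.integrable_bound)
    show "integrable lborel (\<lambda>x. B powr (\<alpha> - 1) * heat 0 t x)"
      using integrable_heat_0[OF assms(1)] by simp
    show "(\<lambda>x. heat 0 t x powr \<alpha>) \<in> borel_measurable lborel"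
      using integrable_heat_0[OF assms(1)] by auto
    show "AE x in lborel. norm (heat 0 t x powr \<alpha>) \<le> norm (B powr (\<alpha> - 1) * heat 0 t x)"
    proof (rule AE_I2)
      fix x
      have u: "heat 0 t x > 0" using heat_0_pos assms by simp
      have "heat 0 t x powr \<alpha> = heat 0 t x powr (\<alpha> - 1) * heat 0 t x"
        using u by (simp add: powr_diff)
      also have "\<dots> \<le> B powr (\<alpha> - 1) * heat 0 t x"
        using u B assms by (intro mult_right_mono powr_mono2) auto
      finally show "norm (heat 0 t x powr \<alpha>) \<le> norm (B powr (\<alpha> - 1) * heat 0 t x)"
        using u B by simp
    qed
  qed
qed

text \<open>For \<open>\<alpha> \<le> 1\<close> Jensen's inequality points in the wrong direction, but the power is subadditive,
so \<open>g\<close> may be cut into pieces.  Up to factors that depend on the time only, the integral of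
\<open>u(t)\<^sup>\<alpha>\<close> is the sum of the \<open>\<alpha>\<close>-th powers of the masses that \<open>g\<close> gives to the cells
\<open>[j, j + 1)\<close>, and this sum does not depend on the time.\<close>

definition cell :: "int \<Rightarrow> real \<Rightarrow> real" where
  "cell j = indicator {of_int j..<of_int j + 1}"

definition cell_mass :: "int \<Rightarrow> real" where
  "cell_mass j = (LINT y|lborel. cell j y * g y)"

lemma cell_eq: "cell j x = (if \<lfloor>x\<rfloor> = j then 1 else 0)"
  by (auto simp: cell_def indicator_def floor_eq_iff)

lemma cell_near: "cell j y \<noteq> 0 \<Longrightarrow> \<bar>y - of_int j\<bar> \<le> 1"
  by (auto simp: cell_def indicator_def split: if_splits)

lemma cell_meas[measurable]: "cell j \<in> borel_measurable borel"
  by (simp add: cell_def)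

lemma cell_g_integrable: "integrable lborel (\<lambda>y. cell j y * g y)"
  using integrable_real_mult_indicator[OF _ g_int, of "{of_int j..<of_int j + 1}"]
  by (simp add: cell_def mult.commute)

lemma cell_mass_nonneg: "cell_mass j \<ge> 0"
  unfolding cell_mass_def by (intro integral_nonneg_AE AE_I2) (simp add: cell_eq g_nonneg)

lemma cell_heat_integrable:
  assumes "t > 0"
  shows "integrable lborel (\<lambda>y. cell j y * (g y * heat_kernel 0 t (x - y)))"
  using integrable_real_mult_indicator[OF _ heat_integrand[OF assms, of 0 x], of "{of_int j..<of_int j + 1}"]
  by (simp add: cell_def mult.commute)

lemma heat_0_ge_cell_mass:
  assumes s: "s > 0" and x: "cell j x \<noteq> 0"
  shows "exp (- 1 / (2 * s)) / sqrt (2 * pi * s) * cell_mass j \<le> heat 0 s x"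
proof -
  let ?c = "exp (- 1 / (2 * s)) / sqrt (2 * pi * s)"
  have "(LINT y|lborel. ?c * (cell j y * g y)) \<le> (LINT y|lborel. g y * heat_kernel 0 s (x - y))"
  proof (rule integral_mono)
    fix y
    show "?c * (cell j y * g y) \<le> g y * heat_kernel 0 s (x - y)"
    proof (cases "cell j y = 0")
      case True
      then show ?thesis using g_nonneg[of y] heat_kernel_0_pos[OF s, of "x - y"] by simp
    next
      case False
      then have "\<bar>x - y\<bar> \<le> 1" using x
        by (auto simp: cell_def indicator_def split: if_splits)
      then have "(x - y)\<^sup>2 \<le> 1" by (simp add: abs_square_le_1)
      then have "(x - y)\<^sup>2 / (2 * s) \<le> 1 / (2 * s)" using s by (intro divide_right_mono) auto
      then have "?c \<le> heat_kernel 0 s (x - y)"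
        using s by (simp add: heat_kernel_0 divide_right_mono)
      then have "g y * ?c \<le> g y * heat_kernel 0 s (x - y)" by (intro mult_left_mono g_nonneg)
      moreover have "cell j y = 1" using False by (simp add: cell_eq split: if_splits)
      ultimately show ?thesis by (simp add: mult.commute)
    qed
  qed (use s heat_integrand cell_g_integrable in auto)
  then show ?thesis by (simp add: heat_def cell_mass_def)
qed

lemma cell_heat_le:
  assumes t: "t > 0"
  shows "(LINT y|lborel. cell j y * (g y * heat_kernel 0 t (x - y)))
     \<le> exp (1 / (2 * t)) / sqrt (2 * pi * t) * exp (- (x - of_int j)\<^sup>2 / (4 * t)) * cell_mass j"
proof -
  let ?B = "exp (1 / (2 * t)) / sqrt (2 * pi * t) * exp (- (x - of_int j)\<^sup>2 / (4 * t))"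
  have "(LINT y|lborel. cell j y * (g y * heat_kernel 0 t (x - y))) \<le> (LINT y|lborel. ?B * (cell j y * g y))"
  proof (rule integral_mono)
    fix y
    show "cell j y * (g y * heat_kernel 0 t (x - y)) \<le> ?B * (cell j y * g y)"
    proof (cases "cell j y = 0")
      case False
      then have "\<bar>y - of_int j\<bar> \<le> 1" by (rule cell_near)
      then have 1: "(y - of_int j)\<^sup>2 \<le> 1" by (simp add: abs_square_le_1)
      \<comment> \<open>This is the square of \<open>(x - y) - (y - j)\<close>, since \<open>x - j = (x - y) + (y - j)\<close>.\<close>
      have "0 \<le> (2 * (x - y) - (x - of_int j))\<^sup>2" by simp
      then have "(x - of_int j)\<^sup>2 \<le> 2 * (x - y)\<^sup>2 + 2 * (y - of_int j)\<^sup>2"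
        by (simp add: power2_eq_square algebra_simps)
      then have "(x - of_int j)\<^sup>2 / (4 * t) \<le> (2 * (x - y)\<^sup>2 + 2) / (4 * t)"
        using 1 t by (intro divide_right_mono) auto
      also have "\<dots> = (x - y)\<^sup>2 / (2 * t) + 1 / (2 * t)"
        using t by (simp add: field_simps)
      finally have "exp (- (x - y)\<^sup>2 / (2 * t)) \<le> exp (1 / (2 * t) + - (x - of_int j)\<^sup>2 / (4 * t))"
        by simp
      then have "heat_kernel 0 t (x - y) \<le> ?B"
        using t unfolding exp_add heat_kernel_0 by (simp add: field_simps)
      then have "g y * heat_kernel 0 t (x - y) \<le> g y * ?B" by (intro mult_left_mono g_nonneg)
      moreover have "cell j y = 1" using False by (simp add: cell_eq split: if_splits)
      ultimately show ?thesis by (simp add: mult.commute)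
    qed simp
  qed (use t cell_heat_integrable cell_g_integrable in auto)
  then show ?thesis by (simp add: cell_mass_def)
qed

lemma cell_mass_powr_sum_le:
  assumes s: "s > 0" "\<alpha> > 0" and int: "integrable lborel (\<lambda>x. heat 0 s x powr \<alpha>)" and "finite J"
  shows "(\<Sum>j\<in>J. (exp (- 1 / (2 * s)) / sqrt (2 * pi * s) * cell_mass j) powr \<alpha>) \<le> (LINT x|lborel. heat 0 s x powr \<alpha>)"
proof -
  let ?c = "\<lambda>j. (exp (- 1 / (2 * s)) / sqrt (2 * pi * s) * cell_mass j) powr \<alpha>"
  have intc: "integrable lborel (cell j)" "(LINT x|lborel. cell j x) = 1" for j
    by (simp_all add: cell_def)
  have "(\<Sum>j\<in>J. ?c j) = (LINT x|lborel. (\<Sum>j\<in>J. ?c j * cell j x))"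
    using intc by simp
  also have "\<dots> \<le> (LINT x|lborel. heat 0 s x powr \<alpha>)"
  proof (rule integral_mono)
    show "integrable lborel (\<lambda>x. \<Sum>j\<in>J. ?c j * cell j x)"
      using intc by (intro Bochner_Integration.integrable_sum integrable_mult_right)
    fix x
    have "(\<Sum>j\<in>J. ?c j * cell j x) = (\<Sum>j\<in>J. if j = \<lfloor>x\<rfloor> then ?c j else 0)"
      by (intro sum.cong) (auto simp: cell_eq)
    also have "\<dots> \<le> heat 0 s x powr \<alpha>"
    proof -
      have "cell \<lfloor>x\<rfloor> x \<noteq> 0" by (simp add: cell_eq)
      from heat_0_ge_cell_mass[OF s(1) this] have "?c \<lfloor>x\<rfloor> \<le> heat 0 s x powr \<alpha>"
        using s cell_mass_nonneg by (intro powr_mono2) auto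
      then show ?thesis using \<open>finite J\<close> by simp
    qed
    finally show "(\<Sum>j\<in>J. ?c j * cell j x) \<le> heat 0 s x powr \<alpha>" .
  qed (rule int)
  finally show ?thesis .
qed

definition heat_cells :: "nat \<Rightarrow> real \<Rightarrow> real \<Rightarrow> real" where
  "heat_cells N t x = (\<Sum>j\<in>{- int N..<int N}. LINT y|lborel. cell j y * (g y * heat_kernel 0 t (x - y)))"

lemma heat_cells_tendsto:
  assumes t: "t > 0"
  shows "(\<lambda>N. heat_cells N t x) \<longlonglongrightarrow> heat 0 t x"
proof -
  have eq: "heat_cells N t x = (LINT y|lborel. (\<Sum>j\<in>{- int N..<int N}. cell j y) * (g y * heat_kernel 0 t (x - y)))" for N
    using cell_heat_integrable[OF t] by (simp add: heat_cells_def sum_distrib_right)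
  have ind: "(\<Sum>j\<in>{- int N..<int N}. cell j y) = (if \<lfloor>y\<rfloor> \<in> {- int N..<int N} then 1 else 0)" for N y
    by (simp add: cell_eq sum.delta)
  have nn: "0 \<le> g y * heat_kernel 0 t (x - y)" for y
    using g_nonneg[of y] heat_kernel_0_pos[OF t, of "x - y"] by simp
  show ?thesis
    unfolding eq heat_def
  proof (rule integral_dominated_convergence[where w = "\<lambda>y. g y * heat_kernel 0 t (x - y)"])
    show "AE y in lborel. (\<lambda>N. (\<Sum>j\<in>{- int N..<int N}. cell j y) * (g y * heat_kernel 0 t (x - y)))
        \<longlonglongrightarrow> g y * heat_kernel 0 t (x - y)"
    proof (intro AE_I2 tendsto_eventually)
      fix y :: real
      have "\<forall>\<^sub>F N in sequentially. \<lfloor>y\<rfloor> \<in> {- int N..<int N}"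
        using eventually_gt_at_top[of "nat \<bar>\<lfloor>y\<rfloor>\<bar>"] by eventually_elim auto
      then show "\<forall>\<^sub>F N in sequentially. (\<Sum>j\<in>{- int N..<int N}. cell j y) * (g y * heat_kernel 0 t (x - y)) = g y * heat_kernel 0 t (x - y)"
        by eventually_elim (simp add: ind)
    qed
    show "AE y in lborel. norm ((\<Sum>j\<in>{- int N..<int N}. cell j y) * (g y * heat_kernel 0 t (x - y))) \<le> g y * heat_kernel 0 t (x - y)" for N
      using nn by (auto simp: ind)
  qed (use t heat_integrand in auto)
qed

text \<open>The integral at time \<open>s\<close> controls the powers of the cell masses; these bound the truncated
solutions \<open>heat_cells\<close> at time \<open>t\<close> uniformly, and Fatou's lemma removes the truncation.\<close>

lemma integrable_heat_powr_propagates: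
  assumes s: "s > 0" and t: "t > 0" and \<alpha>: "0 < \<alpha>" "\<alpha> \<le> 1"
    and int: "integrable lborel (\<lambda>x. heat 0 s x powr \<alpha>)"
  shows "integrable lborel (\<lambda>x. heat 0 t x powr \<alpha>)"
proof -
  define c where "c = exp (- 1 / (2 * s)) / sqrt (2 * pi * s)"
  define B where "B = exp (1 / (2 * t)) / sqrt (2 * pi * t)"
  \<comment> \<open>The Gaussian factor of \<open>cell_heat_le\<close> has variance \<open>2 t\<close>; its power \<open>\<alpha>\<close> has variance \<open>\<tau>\<close>.\<close>
  define \<tau> where "\<tau> = 2 * t / \<alpha>"
  define F where "F = (LINT x|lborel. heat 0 s x powr \<alpha>)"
  have pos: "c > 0" "B > 0" "\<tau> > 0" using s t \<alpha> by (auto simp: c_def B_def \<tau>_def)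
  define G where "G = (B / c) powr \<alpha> * sqrt (2 * pi * \<tau>) * F"
  have heat_cells_nonneg: "heat_cells N t x \<ge> 0" for N x
    unfolding heat_cells_def
    by (intro sum_nonneg integral_nonneg_AE AE_I2 mult_nonneg_nonneg g_nonneg less_imp_le[OF heat_kernel_0_pos] t)
       (simp add: cell_eq)
  have pt: "heat_cells N t x powr \<alpha> \<le> (\<Sum>j\<in>{- int N..<int N}. (B * cell_mass j) powr \<alpha> * (sqrt (2 * pi * \<tau>) * heat_kernel 0 \<tau> (x - of_int j)))" for N x
  proof -
    have "heat_cells N t x \<le> (\<Sum>j\<in>{- int N..<int N}. B * exp (- (x - of_int j)\<^sup>2 / (4 * t)) * cell_mass j)"
      unfolding heat_cells_def B_def by (intro sum_mono cell_heat_le t)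
    then have "heat_cells N t x powr \<alpha> \<le> (\<Sum>j\<in>{- int N..<int N}. B * exp (- (x - of_int j)\<^sup>2 / (4 * t)) * cell_mass j) powr \<alpha>"
      using heat_cells_nonneg \<alpha> by (intro powr_mono2) auto
    also have "\<dots> \<le> (\<Sum>j\<in>{- int N..<int N}. (B * exp (- (x - of_int j)\<^sup>2 / (4 * t)) * cell_mass j) powr \<alpha>)"
      using \<alpha> pos cell_mass_nonneg by (intro powr_sum_le) auto
    also have "\<dots> = (\<Sum>j\<in>{- int N..<int N}. (B * cell_mass j) powr \<alpha> * (sqrt (2 * pi * \<tau>) * heat_kernel 0 \<tau> (x - of_int j)))"
    proof (intro sum.cong refl)
      fix j :: int
      have "exp (- (x - of_int j)\<^sup>2 / (4 * t)) powr \<alpha> = exp (- (x - of_int j)\<^sup>2 / (2 * \<tau>))"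
        using \<alpha> t by (simp add: powr_def \<tau>_def)
      also have "\<dots> = sqrt (2 * pi * \<tau>) * heat_kernel 0 \<tau> (x - of_int j)"
        using pos by (simp add: heat_kernel_0)
      finally show "(B * exp (- (x - of_int j)\<^sup>2 / (4 * t)) * cell_mass j) powr \<alpha>
          = (B * cell_mass j) powr \<alpha> * (sqrt (2 * pi * \<tau>) * heat_kernel 0 \<tau> (x - of_int j))"
        using pos cell_mass_nonneg[of j] by (simp add: powr_mult mult_ac)
    qed
    finally show ?thesis .
  qed
  have bnd: "(\<integral>\<^sup>+x. ennreal (heat_cells N t x powr \<alpha>) \<partial>lborel) \<le> ennreal G" for N
  proof -
    let ?R = "\<lambda>x. \<Sum>j\<in>{- int N..<int N}. (B * cell_mass j) powr \<alpha> * (sqrt (2 * pi * \<tau>) * heat_kernel 0 \<tau> (x - of_int j))"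
    have intR: "integrable lborel ?R"
      using pos heat_kernel_0_integral(1) by (intro Bochner_Integration.integrable_sum integrable_mult_right) auto
    have "(\<integral>\<^sup>+x. ennreal (heat_cells N t x powr \<alpha>) \<partial>lborel) \<le> (\<integral>\<^sup>+x. ennreal (?R x) \<partial>lborel)"
      by (intro nn_integral_mono ennreal_leI pt)
    also have "\<dots> = ennreal (LINT x|lborel. ?R x)"
      using pos by (intro nn_integral_eq_integral intR AE_I2 sum_nonneg mult_nonneg_nonneg less_imp_le[OF heat_kernel_0_pos]) auto
    also have "(LINT x|lborel. ?R x) = (\<Sum>j\<in>{- int N..<int N}. (B * cell_mass j) powr \<alpha> * sqrt (2 * pi * \<tau>))"
      using pos heat_kernel_0_integral(1,2) by (simp add: Bochner_Integration.integral_sum)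
    also have "\<dots> = (B / c) powr \<alpha> * sqrt (2 * pi * \<tau>) * (\<Sum>j\<in>{- int N..<int N}. (c * cell_mass j) powr \<alpha>)"
      unfolding sum_distrib_left using pos cell_mass_nonneg
      by (intro sum.cong refl) (simp add: powr_mult powr_divide field_simps)
    also have "\<dots> \<le> G"
      unfolding G_def F_def c_def using s \<alpha> int pos
      by (intro mult_left_mono cell_mass_powr_sum_le) auto
    finally show ?thesis by (simp add: ennreal_leI)
  qed
  have meas: "(\<lambda>x. heat_cells N t x powr \<alpha>) \<in> borel_measurable lborel" for N
    unfolding heat_cells_def using t by measurable
  have "(\<integral>\<^sup>+x. ennreal (heat 0 t x powr \<alpha>) \<partial>lborel) = (\<integral>\<^sup>+x. liminf (\<lambda>N. ennreal (heat_cells N t x powr \<alpha>)) \<partial>lborel)"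
  proof (rule nn_integral_cong)
    fix x
    have "(\<lambda>N. ennreal (heat_cells N t x powr \<alpha>)) \<longlonglongrightarrow> ennreal (heat 0 t x powr \<alpha>)"
      using heat_0_pos[OF t, of x] by (intro tendsto_ennrealI tendsto_powr heat_cells_tendsto t tendsto_const) auto
    then show "ennreal (heat 0 t x powr \<alpha>) = liminf (\<lambda>N. ennreal (heat_cells N t x powr \<alpha>))"
      by (intro lim_imp_Liminf[symmetric]) auto
  qed
  also have "\<dots> \<le> liminf (\<lambda>N. \<integral>\<^sup>+x. ennreal (heat_cells N t x powr \<alpha>) \<partial>lborel)"
    by (intro nn_integral_liminf measurable_compose[OF meas] measurable_ennreal)
  also have "\<dots> \<le> ennreal G"
    using bnd by (intro Liminf_le) auto
  also have "\<dots> < \<infinity>" by simp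
  finally show ?thesis
    using integrable_heat_0[OF t] by (intro integrableI_bounded) auto
qed

end

section \<open>Positive definite Gram matrices\<close>

definition dot :: "real list \<Rightarrow> real list \<Rightarrow> real" where
  "dot xs ys = sum_list (map2 (*) xs ys)"

text \<open>A symmetric matrix is given by the rows of its upper triangle, each starting at the diagonal,
so that eliminating the first variable is a recursion on the list of rows.\<close>

fun quad_form :: "real list list \<Rightarrow> real list \<Rightarrow> real" where
  "quad_form ((a # r) # M) (x # xs) = a * x ^ 2 + 2 * x * dot r xs + quad_form M xs"
| "quad_form _ _ = 0"

fun schur :: "real \<Rightarrow> real list \<Rightarrow> real list list \<Rightarrow> real list list" where
  "schur a (q # r) (cs # M) = map2 (\<lambda>m p. m - q * p / a) cs (q # r) # schur a r M"
| "schur _ _ _ = []"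

lemma length_schur: "length (schur a r M) \<le> length M"
  by (induction a r M rule: schur.induct) auto

text \<open>Symmetric Gaussian elimination; every pivot has to be positive.\<close>

function posdef :: "real list list \<Rightarrow> bool" where
  "posdef [] = True"
| "posdef ([] # M) = False"
| "posdef ((a # r) # M) = (a > 0 \<and> posdef (schur a r M))"
  by pat_completeness auto
termination
  by (relation "Wellfounded.measure length") (auto simp: length_schur less_Suc_eq_le)

fun triangular :: "real list list \<Rightarrow> bool" where
  "triangular [] = True"
| "triangular (r # M) = (length r = Suc (length M) \<and> triangular M)"

lemma dot_Nil [simp]: "dot [] [] = 0"
  by (simp add: dot_def)

lemma dot_Cons [simp]: "dot (x # xs) (y # ys) = x * y + dot xs ys"
  by (simp add: dot_def)

lemma dot_map2:
  "length r = length p \<Longrightarrow> length p = length xs \<Longrightarrow>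
    dot (map2 (\<lambda>m p. m - q * p / a) r p) xs = dot r xs - q / a * dot p xs"
  by (induction r p xs rule: list_induct3) (simp_all add: algebra_simps)

lemma quad_form_schur:
  assumes "a \<noteq> 0" "triangular M" "length r = length M" "length xs = length M"
  shows "quad_form (schur a r M) xs = quad_form M xs - (dot r xs)\<^sup>2 / a"
  using assms(2-4)
proof (induction M arbitrary: r xs)
  case Nil
  then show ?case by simp
next
  case (Cons cs M)
  from Cons.prems obtain m ms q r' x xs' where
    [simp]: "cs = m # ms" "r = q # r'" "xs = x # xs'"
    by (cases cs; cases r; cases xs) auto
  have "quad_form (schur a r' M) xs' = quad_form M xs' - (dot r' xs')\<^sup>2 / a"
    using Cons by auto
  moreover have "quad_form (schur a r (cs # M)) xs = (m - q * q / a) * x\<^sup>2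
      + 2 * x * (dot ms xs' - q / a * dot r' xs') + quad_form (schur a r' M) xs'"
    using Cons.prems by (simp add: dot_map2)
  ultimately have "quad_form (schur a r (cs # M)) xs = (m - q * q / a) * x\<^sup>2
      + 2 * x * (dot ms xs' - q / a * dot r' xs') + (quad_form M xs' - (dot r' xs')\<^sup>2 / a)"
    by simp
  also have "\<dots> = m * x\<^sup>2 + 2 * x * dot ms xs' + quad_form M xs' - (q * x + dot r' xs')\<^sup>2 / a"
    using assms(1) by (simp add: power2_eq_square field_simps)
  finally show ?case by simp
qed

lemma triangular_schur: "triangular M \<Longrightarrow> length r = length M \<Longrightarrow> triangular (schur a r M) \<and> length (schur a r M) = length M"
proof (induction M arbitrary: r)
  case (Cons cs M)
  then show ?case by (cases r) auto
qed simp

lemma quad_form_nonneg: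
  assumes "triangular M" "posdef M" "length xs = length M"
  shows "quad_form M xs \<ge> 0"
  using assms
proof (induction M arbitrary: xs rule: posdef.induct)
  case (3 a r M)
  from 3(4) obtain x xs' where [simp]: "xs = x # xs'" by (cases xs) auto
  have a: "a > 0" and len: "length r = length M" "length xs' = length M" and up: "triangular M"
    using 3(2-4) by auto
  have "quad_form (schur a r M) xs' \<ge> 0"
    using 3 triangular_schur[OF up len(1)] len by auto
  then have "quad_form M xs' - (dot r xs')\<^sup>2 / a \<ge> 0"
    using quad_form_schur[of a M r xs'] a up len by simp
  moreover have "quad_form ((a # r) # M) xs = a * (x + dot r xs' / a)\<^sup>2 + (quad_form M xs' - (dot r xs')\<^sup>2 / a)"
    using a by (simp add: power2_eq_square field_simps)
  moreover have "a * (x + dot r xs' / a)\<^sup>2 \<ge> 0"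
    using a by simp
  ultimately show ?case by linarith
qed auto

text \<open>For a list \<open>c\<^sub>0, ..., c\<^sub>D\<close> this is the sum of the \<open>c\<^sub>i p\<^sup>i q\<^bsup>D-i\<^esup>\<close>.  With \<open>q = 1 - p\<close> it is a
polynomial of degree \<open>D\<close> in Bernstein form, the binomial coefficients being part of the \<open>c\<^sub>i\<close>.\<close>

fun bernstein_sum :: "real \<Rightarrow> real \<Rightarrow> real list \<Rightarrow> real" where
  "bernstein_sum p q [] = 0"
| "bernstein_sum p q (c # cs) = c * q ^ length cs + p * bernstein_sum p q cs"

lemma bernstein_sum_nonneg:
  "p \<ge> 0 \<Longrightarrow> q \<ge> 0 \<Longrightarrow> \<forall>c\<in>set cs. c \<ge> 0 \<Longrightarrow> bernstein_sum p q cs \<ge> 0"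
  by (induction cs) auto


section \<open>Dissipation polynomials and sums of squares\<close>

text \<open>These rules evaluate the list recursions on concrete differential polynomials and leave a
polynomial identity over the reals.\<close>

lemmas dpoly_eval = total.simps bumps.simps list.map append.simps peval_Cons peval_Nil
  prod_list.Cons prod_list.Nil list.size of_nat_add of_nat_0 of_nat_1 of_nat_Suc add_0_left add_0_right prod.case
  One_nat_def[symmetric] one_add_one of_nat_numeral arith_simps add_numeral_special arith_special
lemmas sos_eval = bernstein_sum.simps quad_form.simps dot_Nil dot_Cons

text \<open>The polynomials \<open>dissip1\<close> to \<open>dissip5\<close> arise from \<open>y\<^sub>1\<^sup>2\<close> by repeatedly applying
\<open>- total 2 \<alpha>\<close> and integrating by parts until no monomial contains its highest derivative to the
first power only.  The polynomials \<open>flux\<close> record these integrations by parts.  A monomial of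
degree \<open>d\<close> in \<open>dissip n\<close> carries the factor \<open>(\<alpha> - 2) \<cdots> (\<alpha> - d + 1)\<close>, because it stems
from the \<open>d\<close>-th derivative of \<open>u\<^sup>\<alpha> / (\<alpha> (\<alpha> - 1))\<close> with respect to \<open>u\<close>.\<close>

definition dissip1 :: "real \<Rightarrow> dpoly" where
  "dissip1 \<alpha> =
   [(1, [1, 1])]"

definition dissip2 :: "real \<Rightarrow> dpoly" where
  "dissip2 \<alpha> =
   [(2, [2, 2]),
    (- (1 / 3 * (\<alpha> - 2) * (\<alpha> - 3)), [1, 1, 1, 1])]"

definition dissip3 :: "real \<Rightarrow> dpoly" where
  "dissip3 \<alpha> =
   [(4, [3, 3]),
    (- (4 * (\<alpha> - 2)), [2, 2, 2]),
    (- (6 * (\<alpha> - 2) * (\<alpha> - 3)), [2, 2, 1, 1]),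
    (1 / 5 * (\<alpha> - 2) * (\<alpha> - 3) * (\<alpha> - 4) * (\<alpha> - 5), [1, 1, 1, 1, 1, 1])]"

definition dissip4 :: "real \<Rightarrow> dpoly" where
  "dissip4 \<alpha> =
   [(8, [4, 4]),
    (- (32 * (\<alpha> - 2)), [3, 3, 2]),
    (- (16 * (\<alpha> - 2) * (\<alpha> - 3)), [3, 3, 1, 1]),
    (12 * (\<alpha> - 2) * (\<alpha> - 3), [2, 2, 2, 2]),
    (32 * (\<alpha> - 2) * (\<alpha> - 3) * (\<alpha> - 4), [2, 2, 2, 1, 1]),
    (12 * (\<alpha> - 2) * (\<alpha> - 3) * (\<alpha> - 4) * (\<alpha> - 5), [2, 2, 1, 1, 1, 1]),
    (- (1 / 7 * (\<alpha> - 2) * (\<alpha> - 3) * (\<alpha> - 4) * (\<alpha> - 5) * (\<alpha> - 6) * (\<alpha> - 7)), [1, 1, 1, 1, 1, 1, 1, 1])]"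

definition dissip5 :: "real \<Rightarrow> dpoly" where
  "dissip5 \<alpha> =
   [(16, [5, 5]),
    (- (80 * (\<alpha> - 2)), [4, 4, 2]),
    (- (40 * (\<alpha> - 2) * (\<alpha> - 3)), [4, 4, 1, 1]),
    (320 / 3 * (\<alpha> - 2) * (\<alpha> - 3), [3, 3, 3, 1]),
    (240 * (\<alpha> - 2) * (\<alpha> - 3), [3, 3, 2, 2]),
    (320 * (\<alpha> - 2) * (\<alpha> - 3) * (\<alpha> - 4), [3, 3, 2, 1, 1]),
    (40 * (\<alpha> - 2) * (\<alpha> - 3) * (\<alpha> - 4) * (\<alpha> - 5), [3, 3, 1, 1, 1, 1]),
    (- (56 * (\<alpha> - 2) * (\<alpha> - 3) * (\<alpha> - 4)), [2, 2, 2, 2, 2]),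
    (- (220 * (\<alpha> - 2) * (\<alpha> - 3) * (\<alpha> - 4) * (\<alpha> - 5)), [2, 2, 2, 2, 1, 1]),
    (- (120 * (\<alpha> - 2) * (\<alpha> - 3) * (\<alpha> - 4) * (\<alpha> - 5) * (\<alpha> - 6)), [2, 2, 2, 1, 1, 1, 1]),
    (- (20 * (\<alpha> - 2) * (\<alpha> - 3) * (\<alpha> - 4) * (\<alpha> - 5) * (\<alpha> - 6) * (\<alpha> - 7)), [2, 2, 1, 1, 1, 1, 1, 1]),
    (1 / 9 * (\<alpha> - 2) * (\<alpha> - 3) * (\<alpha> - 4) * (\<alpha> - 5) * (\<alpha> - 6) * (\<alpha> - 7) * (\<alpha> - 8) * (\<alpha> - 9), [1, 1, 1, 1, 1, 1, 1, 1, 1, 1])]"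

definition flux1 :: "real \<Rightarrow> dpoly" where
  "flux1 \<alpha> =
   [(2, [2, 1]),
    (2 / 3 - 1 / 3 * \<alpha>, [1, 1, 1])]"

lemma dissip_step1: "peval y (total 2 \<alpha> (dissip1 \<alpha>)) + peval y (dissip2 \<alpha>) = peval y (total 1 \<alpha> (flux1 \<alpha>))"
  unfolding dissip1_def dissip2_def flux1_def by (simp only: dpoly_eval) algebra

definition flux2 :: "real \<Rightarrow> dpoly" where
  "flux2 \<alpha> =
   [(4, [3, 2]),
    (4 - 2 * \<alpha>, [2, 2, 1]),
    (- 8 + 20 / 3 * \<alpha> - 4 / 3 * \<alpha> ^ 2, [2, 1, 1, 1]),
    (- 24 / 5 + 26 / 5 * \<alpha> - 9 / 5 * \<alpha> ^ 2 + 1 / 5 * \<alpha> ^ 3, [1, 1, 1, 1, 1])]"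

lemma dissip_step2: "peval y (total 2 \<alpha> (dissip2 \<alpha>)) + peval y (dissip3 \<alpha>) = peval y (total 1 \<alpha> (flux2 \<alpha>))"
  unfolding dissip2_def dissip3_def flux2_def by (simp only: dpoly_eval) algebra

definition flux3 :: "real \<Rightarrow> dpoly" where
  "flux3 \<alpha> =
   [(8, [4, 3]),
    (8 - 4 * \<alpha>, [3, 3, 1]),
    (24 - 12 * \<alpha>, [3, 2, 2]),
    (- 72 + 60 * \<alpha> - 12 * \<alpha> ^ 2, [3, 2, 1, 1]),
    (48 - 40 * \<alpha> + 8 * \<alpha> ^ 2, [2, 2, 2, 1]),
    (- 144 + 156 * \<alpha> - 54 * \<alpha> ^ 2 + 6 * \<alpha> ^ 3, [2, 2, 1, 1, 1]),
    (144 - 924 / 5 * \<alpha> + 426 / 5 * \<alpha> ^ 2 - 84 / 5 * \<alpha> ^ 3 + 6 / 5 * \<alpha> ^ 4, [2, 1, 1, 1, 1, 1]),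
    (720 / 7 - 1044 / 7 * \<alpha> + 580 / 7 * \<alpha> ^ 2 - 155 / 7 * \<alpha> ^ 3 + 20 / 7 * \<alpha> ^ 4 - 1 / 7 * \<alpha> ^ 5, [1, 1, 1, 1, 1, 1, 1])]"

lemma dissip_step3: "peval y (total 2 \<alpha> (dissip3 \<alpha>)) + peval y (dissip4 \<alpha>) = peval y (total 1 \<alpha> (flux3 \<alpha>))"
  unfolding dissip3_def dissip4_def flux3_def by (simp only: dpoly_eval) algebra

definition flux4 :: "real \<Rightarrow> dpoly" where
  "flux4 \<alpha> =
   [(16, [5, 4]),
    (16 - 8 * \<alpha>, [4, 4, 1]),
    (128 - 64 * \<alpha>, [4, 3, 2]),
    (- 192 + 160 * \<alpha> - 32 * \<alpha> ^ 2, [4, 3, 1, 1]),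
    (- 64 / 3 + 32 / 3 * \<alpha>, [3, 3, 3]),
    (384 - 320 * \<alpha> + 64 * \<alpha> ^ 2, [3, 3, 2, 1]),
    (- 384 + 416 * \<alpha> - 144 * \<alpha> ^ 2 + 16 * \<alpha> ^ 3, [3, 3, 1, 1, 1]),
    (288 - 240 * \<alpha> + 48 * \<alpha> ^ 2, [3, 2, 2, 2]),
    (- 2304 + 2496 * \<alpha> - 864 * \<alpha> ^ 2 + 96 * \<alpha> ^ 3, [3, 2, 2, 1, 1]),
    (2880 - 3696 * \<alpha> + 1704 * \<alpha> ^ 2 - 336 * \<alpha> ^ 3 + 24 * \<alpha> ^ 4, [3, 2, 1, 1, 1, 1]),
    (1056 - 1144 * \<alpha> + 396 * \<alpha> ^ 2 - 44 * \<alpha> ^ 3, [2, 2, 2, 2, 1]),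
    (- 5760 + 7392 * \<alpha> - 3408 * \<alpha> ^ 2 + 672 * \<alpha> ^ 3 - 48 * \<alpha> ^ 4, [2, 2, 2, 1, 1, 1]),
    (8640 - 12528 * \<alpha> + 6960 * \<alpha> ^ 2 - 1860 * \<alpha> ^ 3 + 240 * \<alpha> ^ 4 - 12 * \<alpha> ^ 5, [2, 2, 1, 1, 1, 1, 1]),
    (- 5760 + 64224 / 7 * \<alpha> - 40832 / 7 * \<alpha> ^ 2 + 13320 / 7 * \<alpha> ^ 3 - 2360 / 7 * \<alpha> ^ 4 + 216 / 7 * \<alpha> ^ 5 - 8 / 7 * \<alpha> ^ 6, [2, 1, 1, 1, 1, 1, 1, 1]),
    (- 4480 + 7696 * \<alpha> - 48860 / 9 * \<alpha> ^ 2 + 18424 / 9 * \<alpha> ^ 3 - 4025 / 9 * \<alpha> ^ 4 + 511 / 9 * \<alpha> ^ 5 - 35 / 9 * \<alpha> ^ 6 + 1 / 9 * \<alpha> ^ 7, [1, 1, 1, 1, 1, 1, 1, 1, 1])]"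

lemma dissip_step4: "peval y (total 2 \<alpha> (dissip4 \<alpha>)) + peval y (dissip5 \<alpha>) = peval y (total 1 \<alpha> (flux4 \<alpha>))"
  unfolding dissip4_def dissip5_def flux4_def by (simp only: dpoly_eval) algebra

text \<open>The first time derivative of the moment of \<open>1\<close> is half the moment of \<open>\<alpha> y\<^sub>2\<close>, which one
integration by parts turns into \<open>- \<alpha> (\<alpha> - 1) y\<^sub>1\<^sup>2\<close>.\<close>

lemma dissip_step0:
  "peval y (total 2 \<alpha> [(1, [])]) + \<alpha> * (\<alpha> - 1) * peval y (dissip1 \<alpha>) = peval y (total 1 \<alpha> [(\<alpha>, [1])])"
  unfolding dissip1_def by (simp add: algebra_simps numeral_2_eq_2)

lemma dissip_sos1: "peval y (dissip1 \<alpha>) = y 1 ^ 2"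
  by (simp add: dissip1_def power2_eq_square)

text \<open>The coefficient in the added derivative of \<open>u\<^sup>\<alpha> y\<^sub>1\<^sup>3\<close> is the one that maximises the remaining
coefficient of \<open>y\<^sub>1\<^sup>4\<close>.\<close>

lemma dissip_sos2:
  "peval y (dissip2 \<alpha>) + peval y (total 1 \<alpha> [(4 / 9 * (\<alpha> - 3), [1, 1, 1])]) =
    2 * (y 2 + 1 / 3 * (\<alpha> - 3) * y 1 ^ 2) ^ 2 + 1 / 9 * \<alpha> * (3 - \<alpha>) * y 1 ^ 4"
  unfolding dissip2_def by (simp only: dpoly_eval) algebra

text \<open>There are three free coefficients in the added derivative.  The first one removes \<open>y\<^sub>2\<^sup>3\<close>, and
the others are chosen such that the monomials \<open>y\<^sub>1\<^sup>2 y\<^sub>2\<^sup>2\<close> and \<open>y\<^sub>1\<^sup>4 y\<^sub>2\<close> are used up by the square.\<close>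

lemma dissip_sos3:
  "peval y (dissip3 (2 - s)) + peval y (total 1 (2 - s) [(- 4 * s, [2, 2, 1]),
      (2 / 3 * s * (1 + 3 * s), [2, 1, 1, 1]), (4 / 15 * s * (1 + 3 * s), [1, 1, 1, 1, 1])]) =
    4 * (y 3 - s * (y 2 * y 1) + 1 / 12 * s * (1 + 3 * s) * y 1 ^ 3) ^ 2
    + s / 180 * (9 * (2 - s) ^ 3 - 12 * (2 - s) ^ 2 + 29 * (2 - s) - 10) * y 1 ^ 6"
  unfolding dissip3_def by (simp only: dpoly_eval) algebra

text \<open>Except for \<open>y\<^sub>n\<^sup>2\<close> all monomials of \<open>dissip n\<close> have a coefficient divisible by \<open>\<alpha> - 2 = - s\<close>, so
\<open>s\<close> can be factored out of the rest of the Gram matrix.  Adding derivatives \<open>total 1\<close> leaves a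
family of Gram matrices; the coefficients here describe a rational point in the interior of the
set of positive definite ones, which was located by semidefinite programming.  The entries are
polynomials of low degree in \<open>s\<close>, and \<open>gram4\<close> lists the Bernstein coefficients on
\<open>0 \<le> s \<le> 1\<close>, times a common denominator, of the matrix that is left after splitting off
the square with \<open>y\<^sub>4\<close>.\<close>

definition sos_flux4 :: "real \<Rightarrow> dpoly" where
  "sos_flux4 s =
   [(- 12 * s + 4 * s ^ 2 - 2 * s ^ 3, [3, 3, 1]),
    (- 10 * s - 2 * s ^ 2 + s ^ 3, [3, 2, 2]),
    (14 * s + 10 * s ^ 2 + 2 * s ^ 3, [3, 2, 1, 1]),
    (- 15 / 2 * s ^ 2 - 1 / 6 * s ^ 3, [3, 1, 1, 1, 1]),
    (- 1063 / 90 * s - 7 * s ^ 2 - 5 / 3 * s ^ 3 + 1 / 3 * s ^ 4, [2, 2, 2, 1]),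
    (1817 / 135 * s + 4697 / 270 * s ^ 2 + 65 / 9 * s ^ 3 - 1 / 3 * s ^ 4 + 1 / 9 * s ^ 5, [2, 2, 1, 1, 1]),
    (- 6 * s - 391 / 50 * s ^ 2 - 8 * s ^ 3 - 1 / 6 * s ^ 4, [2, 1, 1, 1, 1, 1]),
    (- 142 / 35 * s - 1132 / 175 * s ^ 2 - 1991 / 350 * s ^ 3 - 26 / 21 * s ^ 4 - 1 / 42 * s ^ 5, [1, 1, 1, 1, 1, 1, 1])]"

definition gram4 :: "real list list list" where
  "gram4 =
   [[[6048000, 776160, - 327040, - 1814400],
      [114240, 0, - 287280],
      [1555680, - 1330560],
      [1900800]],
    [[44755200, 5775840, - 5425280, - 11890368],
      [2162160, - 2797200, - 670320],
      [22948240, - 14394240],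
      [15448320]],
    [[147571200, 18869760, - 29276800, - 33206544],
      [11420640, - 19958400, 3562020],
      [118017760, - 65269260],
      [56832192]],
    [[284256000, 35562240, - 80853920, - 50866704],
      [29504160, - 60895800, 19256580],
      [314292720, - 164151540],
      [123716907]],
    [[351993600, 42456960, - 132398560, - 45650808],
      [43953840, - 103005000, 39531870],
      [495713120, - 252366660],
      [173908080]],
    [[290001600, 32855760, - 135158240, - 23783760],
      [39953340, - 104365800, 44209620],
      [484292480, - 244031760],
      [160959390]],
    [[158457600, 15906240, - 85382080, - 7183008],
      [22120560, - 63428400, 28574280],
      [289695840, - 145377540],
      [95406900]],
    [[55036800, 4203360, - 31052000, - 2079504],
      [7023240, - 21508200, 10164420],
      [97899760, - 48851460],
      [33143427]],
    [[10886400, 332640, - 5242720, - 1038744],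
      [1078560, - 3213000, 1613430],
      [14533120, - 7067340],
      [5318772]],
    [[907200, - 55440, - 137760, - 273168],
      [44940, - 37800, 34020],
      [82320, 17640],
      [98700]]]"

lemma posdef_gram4: "\<forall>M\<in>set gram4. triangular M \<and> length M = 4 \<and> posdef M"
  unfolding gram4_def by simp

lemma dissip_sos4:
  "peval y (dissip4 (2 - s)) + peval y (total 1 (2 - s) (sos_flux4 s)) =
    8 * (y 4 + s * ((- 3 / 2 + 1 / 2 * s - 1 / 4 * s ^ 2) * (y 3 * y 1)
        + (- 5 / 8 - 1 / 8 * s + 1 / 16 * s ^ 2) * (y 2 ^ 2)
        + (7 / 8 + 5 / 8 * s + 1 / 8 * s ^ 2) * (y 2 * y 1 ^ 2)
        + (- 15 / 32 * s - 1 / 96 * s ^ 2) * (y 1 ^ 4))) ^ 2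
    + s / 604800 * bernstein_sum s (1 - s)
        (map (\<lambda>M. quad_form M [y 3 * y 1, y 2 ^ 2, y 2 * y 1 ^ 2, y 1 ^ 4]) gram4)"
  unfolding dissip4_def sos_flux4_def gram4_def by (simp only: dpoly_eval sos_eval) algebra

text \<open>The construction is the one for \<open>n = 4\<close>; the Bernstein basis now belongs to the interval
\<open>0 \<le> s \<le> 1/2\<close>, which covers \<open>\<alpha> \<ge> 3/2\<close>.\<close>

definition sos_flux5 :: "real \<Rightarrow> dpoly" where
  "sos_flux5 s =
   [(- 34 * s + 34 * s ^ 2 - 28 * s ^ 3, [4, 4, 1]),
    (- 46 * s - 34 * s ^ 2 + 28 * s ^ 3, [4, 3, 2]),
    (26 * s + 32 * s ^ 2 + 12 * s ^ 3, [4, 3, 1, 1]),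
    (46 * s + 42 * s ^ 2, [4, 2, 2, 1]),
    (- 30 * s - 58 * s ^ 2 - 20 * s ^ 3, [4, 2, 1, 1, 1]),
    (6 * s + 18 * s ^ 2, [4, 1, 1, 1, 1, 1]),
    (46 / 3 * s + 34 / 3 * s ^ 2 - 28 / 3 * s ^ 3, [3, 3, 3]),
    (- 274 / 3 * s - 80 * s ^ 2 + 2 * s ^ 3 - 28 / 3 * s ^ 4, [3, 3, 2, 1]),
    (298 / 9 * s + 614 / 9 * s ^ 2 + 62 / 3 * s ^ 3 - 50 / 9 * s ^ 4 - 28 / 9 * s ^ 5, [3, 3, 1, 1, 1]),
    (- 46 * s - 42 * s ^ 2, [3, 2, 2, 2]),
    (167 * s + 233 * s ^ 2 + 91 * s ^ 3, [3, 2, 2, 1, 1]),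
    (- 110 * s - 224 * s ^ 2 - 118 * s ^ 3 - 20 * s ^ 4, [3, 2, 1, 1, 1, 1]),
    (1123 / 45 * s + 2072 / 45 * s ^ 2 + 1624 / 45 * s ^ 3 + 151 / 15 * s ^ 4 + 13 / 15 * s ^ 5, [3, 1, 1, 1, 1, 1, 1]),
    (- 112 * s - 168 * s ^ 2 - 56 * s ^ 3, [2, 2, 2, 2, 1]),
    (1001 / 3 * s + 1844 / 3 * s ^ 2 + 326 * s ^ 3 + 57 * s ^ 4, [2, 2, 2, 1, 1, 1]),
    (- 4828 / 15 * s - 9647 / 15 * s ^ 2 - 6844 / 15 * s ^ 3 - 646 / 5 * s ^ 4 - 63 / 5 * s ^ 5, [2, 2, 1, 1, 1, 1, 1]),
    (1141 / 9 * s + 95149 / 360 * s ^ 2 + 10192 / 45 * s ^ 3 + 3889 / 45 * s ^ 4 + 72 / 5 * s ^ 5 + 13 / 15 * s ^ 6, [2, 1, 1, 1, 1, 1, 1, 1]),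
    (2092 / 27 * s + 323387 / 1620 * s ^ 2 + 116873 / 648 * s ^ 3 + 33526 / 405 * s ^ 4 + 7777 / 405 * s ^ 5 + 98 / 45 * s ^ 6 + 13 / 135 * s ^ 7, [1, 1, 1, 1, 1, 1, 1, 1, 1])]"

definition gram5 :: "real list list list" where
  "gram5 =
   [[[1036800, 190080, - 408960, - 388800, 259200, 24768],
      [552960, - 622080, - 570240, 1036800, - 414720],
      [1589760, 518400, - 984960, 51840],
      [881280, - 1658880, 764640],
      [3487680, - 1641600],
      [913920]],
    [[5177520, 945000, - 2296440, - 2374920, 1895400, - 75528],
      [3895020, - 4362660, - 4119660, 7035660, - 2635740],
      [10290060, 3870180, - 6786180, 417960],
      [6348780, - 11156940, 4877820],
      [22381380, - 10329660],
      [5791036]],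
    [[11242800, 2063880, - 5332500, - 6211080, 5543640, - 690840],
      [11150460, - 12635190, - 12034980, 19694340, - 6896340],
      [27911880, 11815470, - 19533150, 1285470],
      [18725580, - 31309740, 12990780],
      [60470460, - 27324540],
      [15470920]],
    [[13781340, 2812050, - 6594660, - 9067950, 8450730, - 1511694],
      [16763895, - 19416510, - 18324225, 29017035, - 9415845],
      [40786920, 18976680, - 30069630, 1906740],
      [29107755, - 46915605, 18472455],
      [88285095, - 39015945],
      [22393493]],
    [[10345320, 2663820, - 4629510, - 7932330, 7106940, - 1463382],
      [14194170, - 16819245, - 15441435, 23597730, - 6925095],
      [34197840, 16986105, - 26129385, 1306125],
      [25306020, - 39600495, 14776020],
      [73854450, - 31937355],
      [18700172]],
    [[4806540, 1614330, - 1770120, - 4041090, 3036690, - 575334],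
      [6670755, - 7942860, - 6908895, 9886455, - 2416635],
      [16026255, 8086635, - 12187260, 151875],
      [11802510, - 17887635, 6291270],
      [34065675, - 14490495],
      [8777694]],
    [[1296000, 505440, - 283770, - 1029510, 395280, 20358],
      [1561680, - 1739475, - 1341765, 1532520, - 151065],
      [3659310, 1636605, - 2421495, - 270135],
      [2413800, - 3416985, 1104840],
      [7230600, - 3096765],
      [2023230]],
    [[155520, 51840, 6480, - 77760, - 77760, 53460],
      [129600, - 93960, - 35640, - 77760, 81000],
      [255555, 23085, - 25920, - 103275],
      [67635, - 25920, - 5265],
      [311040, - 164160],
      [146025]]]"

lemma posdef_gram5: "\<forall>M\<in>set gram5. triangular M \<and> length M = 6 \<and> posdef M"
  unfolding gram5_def by simp

lemma dissip_sos5: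
  "peval y (dissip5 (2 - s)) + peval y (total 1 (2 - s) (sos_flux5 s)) =
    16 * (y 5 + s * ((- 17 / 8 + 17 / 8 * s - 7 / 4 * s ^ 2) * (y 4 * y 1)
        + (- 23 / 16 - 17 / 16 * s + 7 / 8 * s ^ 2) * (y 3 * y 2)
        + (13 / 16 + s + 3 / 8 * s ^ 2) * (y 3 * y 1 ^ 2)
        + (23 / 16 + 21 / 16 * s) * (y 2 ^ 2 * y 1)
        + (- 15 / 16 - 29 / 16 * s - 5 / 8 * s ^ 2) * (y 2 * y 1 ^ 3)
        + (3 / 16 + 9 / 16 * s) * (y 1 ^ 5))) ^ 2
    + s / 51840 * bernstein_sum (2 * s) (1 - (2 * s))
        (map (\<lambda>M. quad_form M [y 4 * y 1, y 3 * y 2, y 3 * y 1 ^ 2, y 2 ^ 2 * y 1, y 2 * y 1 ^ 3, y 1 ^ 5]) gram5)"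
  unfolding dissip5_def sos_flux5_def gram5_def by (simp only: dpoly_eval sos_eval) algebra

definition dissip :: "nat \<Rightarrow> real \<Rightarrow> dpoly" where
  "dissip n \<alpha> = [dissip1 \<alpha>, dissip2 \<alpha>, dissip3 \<alpha>, dissip4 \<alpha>, dissip5 \<alpha>] ! (n - 1)"

lemma dissip_step:
  assumes "1 \<le> n" "n \<le> 4"
  shows "\<exists>R. \<forall>y. peval y (total 2 \<alpha> (dissip n \<alpha>)) + peval y (dissip (Suc n) \<alpha>) = peval y (total 1 \<alpha> R)"
proof -
  have "n = 1 \<or> n = 2 \<or> n = 3 \<or> n = 4" using assms by auto
  then show ?thesis
    using dissip_step1 dissip_step2 dissip_step3 dissip_step4 by (auto simp: dissip_def)
qed

text \<open>The ranges of the theorem for the choice \<open>\<alpha>\<^sub>1 = 1.545\<close>.\<close>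

definition admissible :: "nat \<Rightarrow> real \<Rightarrow> bool" where
  "admissible n \<alpha> \<longleftrightarrow>
     n = 1 \<and> \<alpha> \<in> {0<..<1} \<union> {1<..} \<or>
     n = 2 \<and> \<alpha> \<in> {0<..<1} \<union> {1<..3} \<or>
     n = 3 \<and> \<alpha> \<in> {alpha0<..<1} \<union> {1<..2} \<or>
     n = 4 \<and> \<alpha> \<in> {1<..<2} \<or>
     n = 5 \<and> \<alpha> \<in> {1.545<..<2}"

lemma alpha0_bounds: "0 < alpha0" "alpha0 < 1"
  using strict_mono_less[OF alpha0_cubic_strict_mono, of 0 alpha0]
    strict_mono_less[OF alpha0_cubic_strict_mono, of alpha0 1] alpha0_root by simp_all

lemma alpha0_cubic_pos: "alpha0 < \<alpha> \<Longrightarrow> 9 * \<alpha> ^ 3 - 12 * \<alpha> ^ 2 + 29 * \<alpha> - 10 > 0"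
  using strict_monoD[OF alpha0_cubic_strict_mono, of alpha0 \<alpha>] alpha0_root by simp

lemma dissip_nonneg_mod_total:
  assumes "admissible n \<alpha>"
  shows "\<exists>R. \<forall>y. peval y (dissip n \<alpha>) + peval y (total 1 \<alpha> R) \<ge> 0"
proof -
  define s where "s = 2 - \<alpha>"
  have \<alpha>: "\<alpha> = 2 - s" by (simp add: s_def)
  consider "n = 1" | "n = 2" "0 < \<alpha>" "\<alpha> \<le> 3" | "n = 3" "alpha0 < \<alpha>" "\<alpha> \<le> 2"
    | "n = 4" "1 < \<alpha>" "\<alpha> < 2" | "n = 5" "1.545 < \<alpha>" "\<alpha> < 2"
  proof -
    show thesis using assms that alpha0_bounds by (auto simp: admissible_def)
  qed
  then show ?thesis
  proof cases
    case 1
    then show ?thesis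
      by (intro exI[of _ "[]"]) (simp add: dissip_def dissip_sos1)
  next
    case 2
    then have "peval y (dissip2 \<alpha>) + peval y (total 1 \<alpha> [(4 / 9 * (\<alpha> - 3), [1, 1, 1])]) \<ge> 0" for y
      unfolding dissip_sos2 by (intro add_nonneg_nonneg mult_nonneg_nonneg divide_nonneg_nonneg) auto
    then have "\<exists>R. \<forall>y. peval y (dissip2 \<alpha>) + peval y (total 1 \<alpha> R) \<ge> 0" by blast
    then show ?thesis using 2 by (simp add: dissip_def)
  next
    case 3
    then have "s \<ge> 0" "9 * (2 - s) ^ 3 - 12 * (2 - s) ^ 2 + 29 * (2 - s) - 10 \<ge> 0"
      using alpha0_cubic_pos[of \<alpha>] by (auto simp: s_def)
    then have "\<exists>R. \<forall>y. peval y (dissip3 (2 - s)) + peval y (total 1 (2 - s) R) \<ge> 0"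
      by (intro exI allI, subst dissip_sos3) (intro add_nonneg_nonneg mult_nonneg_nonneg divide_nonneg_nonneg, auto)
    then show ?thesis using 3 by (simp add: dissip_def \<alpha>)
  next
    case 4
    then have s: "0 \<le> s" "s \<le> 1" by (auto simp: s_def)
    have "peval y (dissip4 (2 - s)) + peval y (total 1 (2 - s) (sos_flux4 s)) \<ge> 0" for y
      unfolding dissip_sos4 using s posdef_gram4
      by (intro add_nonneg_nonneg mult_nonneg_nonneg divide_nonneg_nonneg bernstein_sum_nonneg)
         (auto intro!: quad_form_nonneg)
    then have "\<exists>R. \<forall>y. peval y (dissip4 (2 - s)) + peval y (total 1 (2 - s) R) \<ge> 0" by blast
    then show ?thesis using 4 by (simp add: dissip_def \<alpha>)
  next
    case 5
    then have s: "0 \<le> s" "2 * s \<le> 1" by (auto simp: s_def)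
    have "peval y (dissip5 (2 - s)) + peval y (total 1 (2 - s) (sos_flux5 s)) \<ge> 0" for y
      unfolding dissip_sos5 using s posdef_gram5
      by (intro add_nonneg_nonneg mult_nonneg_nonneg divide_nonneg_nonneg bernstein_sum_nonneg)
         (auto intro!: quad_form_nonneg)
    then have "\<exists>R. \<forall>y. peval y (dissip5 (2 - s)) + peval y (total 1 (2 - s) R) \<ge> 0" by blast
    then show ?thesis using 5 by (simp add: dissip_def \<alpha>)
  qed
qed

section \<open>Derivatives of the entropy\<close>

text \<open>An identity on the open half-line \<open>t > 0\<close> is inherited by the derivatives, step by step.\<close>

lemma iterated_deriv_pos:
  assumes h: "\<And>t. t > 0 \<Longrightarrow> h t = f 0 t"
    and f: "\<And>k t. k < n \<Longrightarrow> t > 0 \<Longrightarrow> (f k has_real_derivative f (Suc k) t) (at t)"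
  shows "times_differentiable_pos n h" and "\<And>t. t > 0 \<Longrightarrow> (deriv ^^ n) h t = f n t"
proof -
  have step: "(H has_real_derivative f (Suc k) t) (at t)"
    if "k < n" "t > 0" "\<And>t. t > 0 \<Longrightarrow> H t = f k t" for H k t
  proof -
    have "\<forall>\<^sub>F s in nhds t. H s = f k s"
      using eventually_nhds_in_open[of "{0<..}" t] that by (auto elim!: eventually_mono)
    then show ?thesis
      using f[OF that(1,2)] DERIV_cong_ev[of t t H "f k"] by simp
  qed
  have eq: "(deriv ^^ k) h t = f k t" if "k \<le> n" "t > 0" for k t
    using that
  proof (induction k arbitrary: t)
    case (Suc k)
    then have "((deriv ^^ k) h has_real_derivative f (Suc k) t) (at t)"
      by (intro step) auto
    then show ?case by (simp add: DERIV_imp_deriv)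
  qed (use h in simp)
  show "(deriv ^^ n) h t = f n t" if "t > 0" for t
    using eq that by simp
  show "times_differentiable_pos n h"
    unfolding times_differentiable_pos_def
  proof (intro allI impI)
    fix k :: nat and t :: real
    assume "k < n" "t > 0"
    then have "((deriv ^^ k) h has_real_derivative f (Suc k) t) (at t)"
      by (intro step) (use eq in auto)
    then show "(deriv ^^ k) h differentiable (at t)"
      by (auto simp: real_differentiable_def)
  qed
qed

context heat_density
begin

lemma moment_eq_of_total:
  assumes t: "t > 0" "\<alpha> > 0" and int: "\<And>t. t > 0 \<Longrightarrow> integrable lborel (\<lambda>x. heat 0 t x powr \<alpha>)"
    and eq: "\<And>y. peval y P + c * peval y Q = peval y (total 1 \<alpha> R)"
  shows "moment \<alpha> P t = - c * moment \<alpha> Q t"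
proof -
  have "moment \<alpha> P t + c * moment \<alpha> Q t = (LINT x|lborel. heat 0 t x powr \<alpha> * (peval (ratio t x) P + c * peval (ratio t x) Q))"
    using integrable_powr_peval[OF t int, of P] integrable_powr_peval[OF t int, of Q]
    by (simp add: moment_def distrib_left mult.left_commute[of _ c])
  also have "\<dots> = moment \<alpha> (total 1 \<alpha> R) t"
    by (simp only: eq moment_def)
  also have "\<dots> = 0" by (rule moment_total_1[OF t int])
  finally show ?thesis by simp
qed

lemma moment_nonneg:
  assumes t: "t > 0" "\<alpha> > 0" and int: "\<And>t. t > 0 \<Longrightarrow> integrable lborel (\<lambda>x. heat 0 t x powr \<alpha>)"
    and nonneg: "\<And>y. peval y P + peval y (total 1 \<alpha> R) \<ge> 0"
  shows "moment \<alpha> P t \<ge> 0"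
proof -
  have "moment \<alpha> P t = moment \<alpha> (P @ total 1 \<alpha> R) t"
    using moment_append[OF t int, of P "total 1 \<alpha> R"] moment_total_1[OF t int, of R] by simp
  also have "\<dots> \<ge> 0"
    unfolding moment_def using nonneg by (intro integral_nonneg_AE AE_I2) simp
  finally show ?thesis .
qed

text \<open>The \<open>n\<close>-th time derivative of the entropy in closed form, provided that the moments converge.\<close>

definition entropy_deriv :: "real \<Rightarrow> nat \<Rightarrow> real \<Rightarrow> real" where
  "entropy_deriv \<alpha> n t = (if n = 0 then 1 / (\<alpha> - 1) * (1 - moment \<alpha> [(1, [])] t)
     else \<alpha> / 2 * (- 1 / 2) ^ (n - 1) * moment \<alpha> (dissip n \<alpha>) t)"

lemma DERIV_entropy_deriv:
  assumes t: "t > 0" "\<alpha> > 0" and int: "\<And>t. t > 0 \<Longrightarrow> integrable lborel (\<lambda>x. heat 0 t x powr \<alpha>)"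
    and "\<alpha> \<noteq> 1" "n < 5"
  shows "(entropy_deriv \<alpha> n has_real_derivative entropy_deriv \<alpha> (Suc n) t) (at t)"
proof (cases n)
  case 0
  have "((\<lambda>t. 1 / (\<alpha> - 1) * (1 - moment \<alpha> [(1, [])] t)) has_real_derivative
      1 / (\<alpha> - 1) * (0 - moment \<alpha> (total 2 \<alpha> [(1, [])]) t / 2)) (at t)"
    by (intro DERIV_cmult DERIV_diff DERIV_const DERIV_moment t int)
  also have "moment \<alpha> (total 2 \<alpha> [(1, [])]) t = - (\<alpha> * (\<alpha> - 1)) * moment \<alpha> (dissip1 \<alpha>) t"
    by (rule moment_eq_of_total[OF t int dissip_step0])
  also have "1 / (\<alpha> - 1) * (0 - - (\<alpha> * (\<alpha> - 1)) * moment \<alpha> (dissip1 \<alpha>) t / 2) = \<alpha> / 2 * moment \<alpha> (dissip1 \<alpha>) t"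
    using \<open>\<alpha> \<noteq> 1\<close> by (simp add: divide_simps)
  finally show ?thesis
    by (simp add: 0 entropy_deriv_def[abs_def] dissip_def)
next
  case (Suc m)
  then have "1 \<le> n" "n \<le> 4" using assms by auto
  then obtain R where R: "\<And>y. peval y (total 2 \<alpha> (dissip n \<alpha>)) + peval y (dissip (Suc n) \<alpha>) = peval y (total 1 \<alpha> R)"
    using dissip_step[of n \<alpha>] by blast
  have "((\<lambda>t. \<alpha> / 2 * (- 1 / 2) ^ (n - 1) * moment \<alpha> (dissip n \<alpha>) t) has_real_derivative
      \<alpha> / 2 * (- 1 / 2) ^ (n - 1) * (moment \<alpha> (total 2 \<alpha> (dissip n \<alpha>)) t / 2)) (at t)"
    by (intro DERIV_cmult DERIV_moment t int)
  also have "moment \<alpha> (total 2 \<alpha> (dissip n \<alpha>)) t = - moment \<alpha> (dissip (Suc n) \<alpha>) t"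
    using moment_eq_of_total[OF t int, of _ 1] R by simp
  finally show ?thesis
    by (simp add: Suc entropy_deriv_def[abs_def])
qed

lemma tsallis_entropy_derivs:
  assumes sol: "bounded_heat_cauchy_solution g u" and adm: "admissible n \<alpha>"
  defines "h \<equiv> \<lambda>t. tsallis_entropy \<alpha> (\<lambda>x. u x t)"
  shows "times_differentiable_pos n h \<and> (\<forall>t>0. (- 1) ^ (n + 1) * (deriv ^^ n) h t \<ge> 0)"
proof -
  have \<alpha>: "\<alpha> > 0" "\<alpha> \<noteq> 1" and n: "1 \<le> n" "n \<le> 5"
    using adm alpha0_bounds by (auto simp: admissible_def)
  have h: "h t = 1 / (\<alpha> - 1) * (1 - (LINT x|lborel. heat 0 t x powr \<alpha>))" if "t > 0" for t
    unfolding h_def tsallis_entropy_def by (simp add: bounded_heat_cauchy_solution_unique[OF sol that])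
  show ?thesis
  proof (cases "\<exists>s>0. integrable lborel (\<lambda>x. heat 0 s x powr \<alpha>)")
    case True
    then obtain s where s: "s > 0" "integrable lborel (\<lambda>x. heat 0 s x powr \<alpha>)" by blast
    have int: "integrable lborel (\<lambda>x. heat 0 t x powr \<alpha>)" if "t > 0" for t
      using integrable_heat_powr_ge_1[OF that] integrable_heat_powr_propagates[OF s(1) that \<alpha>(1) _ s(2)]
      by (cases "\<alpha> \<le> 1") auto
    have h0: "h t = entropy_deriv \<alpha> 0 t" if "t > 0" for t
      using h[OF that] by (simp add: entropy_deriv_def moment_def)
    have d: "(entropy_deriv \<alpha> k has_real_derivative entropy_deriv \<alpha> (Suc k) t) (at t)"
      if "k < n" "t > 0" for k t
      using n that by (intro DERIV_entropy_deriv int \<alpha>) auto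
    have "(- 1) ^ (n + 1) * (deriv ^^ n) h t \<ge> 0" if t: "t > 0" for t
    proof -
      obtain R where R: "\<And>y. peval y (dissip n \<alpha>) + peval y (total 1 \<alpha> R) \<ge> 0"
        using dissip_nonneg_mod_total[OF adm] by blast
      have moment: "moment \<alpha> (dissip n \<alpha>) t \<ge> 0"
        using moment_nonneg[OF t \<alpha>(1), of "dissip n \<alpha>" R] int R by blast
      obtain m where m: "n = Suc m" using n by (cases n) auto
      have "(- 1) ^ (n + 1) * (deriv ^^ n) h t = \<alpha> / 2 * ((- 1) ^ m * (- 1 / 2) ^ m) * moment \<alpha> (dissip n \<alpha>) t"
        using iterated_deriv_pos(2)[of h "entropy_deriv \<alpha>" n, OF h0 d t] by (simp add: entropy_deriv_def m)
      also have "(- 1) ^ m * (- 1 / 2) ^ m = (1 / 2 :: real) ^ m"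
        by (simp flip: power_mult_distrib)
      also have "\<alpha> / 2 * (1 / 2) ^ m * moment \<alpha> (dissip n \<alpha>) t \<ge> 0"
        using moment \<alpha> by simp
      finally show ?thesis .
    qed
    then show ?thesis using iterated_deriv_pos(1)[of h "entropy_deriv \<alpha>" n, OF h0 d] by blast
  next
    case False
    \<comment> \<open>The integral diverges at every time, so that its value is zero by convention.\<close>
    define f where "f k = (\<lambda>t::real. if k = (0::nat) then 1 / (\<alpha> - 1) else 0)" for k
    have h0: "h t = f 0 t" if "t > 0" for t
      using h[OF that] False that by (simp add: f_def not_integrable_integral_eq)
    have d: "(f k has_real_derivative f (Suc k) t) (at t)" for k t
      by (simp add: f_def)
    show ?thesis
      using iterated_deriv_pos[of h f n, OF h0 d] n by (auto simp: f_def)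
  qed
qed

end

theorem theorem1p3:
  shows "\<exists>\<alpha>1::real. 1.54 < \<alpha>1 \<and> \<alpha>1 < 1.55 \<and>
    (\<forall>(g :: real \<Rightarrow> real) (u :: real \<Rightarrow> real \<Rightarrow> real) (\<alpha> :: real) (n :: nat).
       prob_density g \<longrightarrow> continuous_on UNIV g \<longrightarrow> bounded (range g) \<longrightarrow>
       bounded_heat_cauchy_solution g u \<longrightarrow>
       (n = 1 \<and> \<alpha> \<in> {0<..<1} \<union> {1<..} \<or>
        n = 2 \<and> \<alpha> \<in> {0<..<1} \<union> {1<..3} \<or>
        n = 3 \<and> \<alpha> \<in> {alpha0<..<1} \<union> {1<..2} \<or>
        n = 4 \<and> \<alpha> \<in> {1<..<2} \<or>
        n = 5 \<and> \<alpha> \<in> {\<alpha>1<..<2}) \<longrightarrow>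
       times_differentiable_pos n (\<lambda>t. tsallis_entropy \<alpha> (\<lambda>x. u x t)) \<and>
       (\<forall>t>0. (-1) ^ (n + 1) * (deriv ^^ n) (\<lambda>t. tsallis_entropy \<alpha> (\<lambda>x. u x t)) t \<ge> 0))"
proof (intro exI[of _ "1.545"] conjI allI impI)
  fix g :: "real \<Rightarrow> real" and u :: "real \<Rightarrow> real \<Rightarrow> real" and \<alpha> :: real and n :: nat
  assume g: "prob_density g" "continuous_on UNIV g" "bounded (range g)"
    and sol: "bounded_heat_cauchy_solution g u"
    and "n = 1 \<and> \<alpha> \<in> {0<..<1} \<union> {1<..} \<or>
        n = 2 \<and> \<alpha> \<in> {0<..<1} \<union> {1<..3} \<or>
        n = 3 \<and> \<alpha> \<in> {alpha0<..<1} \<union> {1<..2} \<or>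
        n = 4 \<and> \<alpha> \<in> {1<..<2} \<or>
        n = 5 \<and> \<alpha> \<in> {1.545<..<2}"
  then have adm: "admissible n \<alpha>" by (simp add: admissible_def)
  interpret heat_density g
    using g by unfold_locales (auto simp: prob_density_def)
  note derivs = tsallis_entropy_derivs[OF sol adm]
  show "times_differentiable_pos n (\<lambda>t. tsallis_entropy \<alpha> (\<lambda>x. u x t))"
    using derivs by blast
  show "(-1) ^ (n + 1) * (deriv ^^ n) (\<lambda>t. tsallis_entropy \<alpha> (\<lambda>x. u x t)) t \<ge> 0" if "t > 0" for t
    using derivs that by blast
qed simp_all

end
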